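(* Let $A\subset C$ and $B\subset D$ be inclusions of $C^*$-algebras with $\overline{AC}=C$ and $\overline{BD}=D$. Suppose that they are strongly Morita equivalent with respect to a $C$-$D$-equivalence bimodule $Y$ and its closed subspace $X$. Let $\phi\in{}_B\mathbf{B}_B(D,B)$. Then there are a unique linear map $\tau:Y\to X$ and a unique element $\psi\in{}_A\mathbf{B}_A(C,A)$ satisfying, for all $a\in A$, $b\in B$, $c\in C$, $d\in D$, $x\in X$, $y\in Y$: (1) $\tau(c\cdot x)=\psi(c)\cdot x$; (2) $\tau(a\cdot y)=a\cdot\tau(y)$; (3) ${}_A\langle\tau(y),x\rangle=\psi({}_C\langle y,x\rangle)$; (4) $\tau(x\cdot d)=x\cdot\phi(d)$; (5) $\tau(y\cdot b)=\tau(y)\cdot b$; (6) $\phi(\langle x,y\rangle_D)=\langle x,\tau(y)\rangle_B$. Furthermore $\|\psi\|\le\|\tau\|\le\|\phi\|$. Conversely, for every $\psi\in{}_A\mathbf{B}_A(C,A)$ there are a unique linear map $\tau:Y\to X$ and a unique element $\phi\in{}_B\mathbf{B}_B(D,B)$ satisfying (1)-(6), and $\|\phi\|\le\|\tau\|\le\|\psi\|$.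
   Context: For an inclusion $A\subset C$, ${}_A\mathbf{B}_A(C,A)$ is the space of bounded linear maps $\psi:C\to A$ with $\psi(ac)=a\psi(c)$ and $\psi(ca)=\psi(c)a$ for $a\in A$, $c\in C$; similarly ${}_B\mathbf{B}_B(D,B)$. $\overline{AC}$ denotes the closed linear span of products. Strong Morita equivalence of inclusions: $A\subset C$ and $B\subset D$ are strongly Morita equivalent with respect to a $C$-$D$-equivalence (imprimitivity) bimodule $Y$ (left $C$-valued inner product ${}_C\langle\cdot,\cdot\rangle$, right $D$-valued inner product $\langle\cdot,\cdot\rangle_D$) and its closed subspace $X$ if (i) $a\cdot x\in X$, $x\cdot b\in X$, ${}_C\langle x,z\rangle\in A$, $\langle x,z\rangle_D\in B$ for all $a\in A$, $b\in B$, $x,z\in X$; (ii) the closed linear spans of ${}_C\langle X,X\rangle$, $\langle X,X\rangle_D$, ${}_C\langle Y,X\rangle$, $\langle Y,X\rangle_D$ are $A$, $B$, $C$, $D$ respectively. Then $X$ is an $A$-$B$-equivalence bimodule with the restricted actions and inner products, written ${}_A\langle\cdot,\cdot\rangle$ and $\langle\cdot,\cdot\rangle_B$. *)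

theory Defs
  imports "HOL-Analysis.Analysis"
begin

section \<open>Complex normed spaces and C*-algebras\<close>

class scaleC = scaleR +
  fixes scaleC :: "complex \<Rightarrow> 'a \<Rightarrow> 'a" (infixr "*\<^sub>C" 75)
  assumes scaleR_scaleC: "r *\<^sub>R x = complex_of_real r *\<^sub>C x"

class complex_vector = scaleC + real_vector +
  assumes scaleC_add_right: "a *\<^sub>C (x + y) = a *\<^sub>C x + a *\<^sub>C y"
    and scaleC_add_left: "(a + b) *\<^sub>C x = a *\<^sub>C x + b *\<^sub>C x"
    and scaleC_scaleC: "a *\<^sub>C (b *\<^sub>C x) = (a * b) *\<^sub>C x"
    and scaleC_one: "1 *\<^sub>C x = x"

interpretation complex_vector: vector_space "scaleC :: complex \<Rightarrow> 'a \<Rightarrow> 'a::complex_vector"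
  by unfold_locales (fact scaleC_add_right scaleC_add_left scaleC_scaleC scaleC_one)+

abbreviation csubspace :: "'a::complex_vector set \<Rightarrow> bool"
  where "csubspace \<equiv> module.subspace scaleC"

abbreviation cspan :: "'a::complex_vector set \<Rightarrow> 'a set"
  where "cspan \<equiv> module.span scaleC"

abbreviation clinear :: "('a::complex_vector \<Rightarrow> 'b::complex_vector) \<Rightarrow> bool"
  where "clinear \<equiv> Vector_Spaces.linear scaleC scaleC"

class complex_normed_vector = complex_vector + real_normed_vector +
  assumes norm_scaleC: "norm (a *\<^sub>C x) = cmod a * norm x"

class cbanach = complex_normed_vector + complete_space

subclass (in cbanach) banach ..

definition bounded_clinear :: "('a::complex_normed_vector \<Rightarrow> 'b::complex_normed_vector) \<Rightarrow> bool"
  where "bounded_clinear f \<longleftrightarrow> clinear f \<and> (\<exists>K. \<forall>x. norm (f x) \<le> norm x * K)"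

definition closed_cspan :: "'a::complex_normed_vector set \<Rightarrow> 'a set"
  where "closed_cspan S = closure (cspan S)"

text \<open>C*-algebras are not required to have a unit, and the zero algebra is allowed.\<close>

class cstar_algebra = cbanach + real_normed_algebra +
  fixes star :: "'a \<Rightarrow> 'a"
  assumes mult_scaleC_left: "(a *\<^sub>C x) * y = a *\<^sub>C (x * y)"
    and mult_scaleC_right: "x * (a *\<^sub>C y) = a *\<^sub>C (x * y)"
    and star_star: "star (star x) = x"
    and star_add: "star (x + y) = star x + star y"
    and star_scaleC: "star (a *\<^sub>C x) = cnj a *\<^sub>C star x"
    and star_mult: "star (x * y) = star y * star x"
    and cstar_identity: "norm (star x * x) = (norm x)\<^sup>2"

definition cstar_positive :: "'a::cstar_algebra \<Rightarrow> bool"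
  where "cstar_positive x \<longleftrightarrow> (\<exists>z. x = star z * z)"

definition cstar_subalgebra :: "'a::cstar_algebra set \<Rightarrow> bool"
  where "cstar_subalgebra A \<longleftrightarrow> csubspace A \<and> closed A \<and>
    (\<forall>x\<in>A. \<forall>y\<in>A. x * y \<in> A) \<and> (\<forall>x\<in>A. star x \<in> A)"

text \<open>The space written \<open>\<^sub>A\<^bold>B\<^sub>A(C, A)\<close>, where \<open>C\<close> is the whole type \<open>'c\<close>.\<close>

definition bimodule_maps :: "'c::cstar_algebra set \<Rightarrow> ('c \<Rightarrow> 'c) set"
  where "bimodule_maps A = {\<psi>. bounded_clinear \<psi> \<and> range \<psi> \<subseteq> A \<and>
    (\<forall>a\<in>A. \<forall>c. \<psi> (a * c) = a * \<psi> c \<and> \<psi> (c * a) = \<psi> c * a)}"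


section \<open>Hilbert modules and equivalence bimodules\<close>

text \<open>
  The module is a Banach space as a type, and its norm is the norm that the inner product induces,
  so completeness is part of the sort \<open>cbanach\<close>. The inner product of a left module is linear in
  the first variable, that of a right module is linear in the second one.
\<close>

locale left_hilbert_module =
  fixes lact :: "'c::cstar_algebra \<Rightarrow> 'y::cbanach \<Rightarrow> 'y"
    and lip :: "'y \<Rightarrow> 'y \<Rightarrow> 'c"
  assumes lact_add_left: "lact (c + c') y = lact c y + lact c' y"
    and lact_add_right: "lact c (y + y') = lact c y + lact c y'"
    and lact_scaleC_left: "lact (k *\<^sub>C c) y = k *\<^sub>C lact c y"
    and lact_scaleC_right: "lact c (k *\<^sub>C y) = k *\<^sub>C lact c y"
    and lact_mult: "lact (c * c') y = lact c (lact c' y)"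
    and lip_add_left: "lip (y + y') z = lip y z + lip y' z"
    and lip_scaleC_left: "lip (k *\<^sub>C y) z = k *\<^sub>C lip y z"
    and lip_lact: "lip (lact c y) z = c * lip y z"
    and lip_star: "star (lip y z) = lip z y"
    and lip_positive: "cstar_positive (lip y y)"
    and norm_lip: "norm y = sqrt (norm (lip y y))"

locale right_hilbert_module =
  fixes ract :: "'y::cbanach \<Rightarrow> 'd::cstar_algebra \<Rightarrow> 'y"
    and rip :: "'y \<Rightarrow> 'y \<Rightarrow> 'd"
  assumes ract_add_left: "ract (y + y') d = ract y d + ract y' d"
    and ract_add_right: "ract y (d + d') = ract y d + ract y d'"
    and ract_scaleC_left: "ract (k *\<^sub>C y) d = k *\<^sub>C ract y d"
    and ract_scaleC_right: "ract y (k *\<^sub>C d) = k *\<^sub>C ract y d"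
    and ract_mult: "ract y (d * d') = ract (ract y d) d'"
    and rip_add_right: "rip z (y + y') = rip z y + rip z y'"
    and rip_scaleC_right: "rip z (k *\<^sub>C y) = k *\<^sub>C rip z y"
    and rip_ract: "rip z (ract y d) = rip z y * d"
    and rip_star: "star (rip y z) = rip z y"
    and rip_positive: "cstar_positive (rip y y)"
    and norm_rip: "norm y = sqrt (norm (rip y y))"

text \<open>
  The norms induced by the two inner products of an equivalence bimodule always agree. Therefore
  letting both component locales refer to the norm of \<open>'y\<close> is no restriction.
\<close>

locale equivalence_bimodule =
  left_hilbert_module lact lip + right_hilbert_module ract rip
  for lact :: "'c::cstar_algebra \<Rightarrow> 'y::cbanach \<Rightarrow> 'y"
    and ract :: "'y \<Rightarrow> 'd::cstar_algebra \<Rightarrow> 'y"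
    and lip :: "'y \<Rightarrow> 'y \<Rightarrow> 'c"
    and rip :: "'y \<Rightarrow> 'y \<Rightarrow> 'd" +
  assumes lact_ract: "ract (lact c y) d = lact c (ract y d)"
    and rip_lact: "rip (lact c y) z = rip y (lact (star c) z)"
    and lip_ract: "lip (ract y d) z = lip y (ract z (star d))"
    and lip_rip: "lact (lip x y) z = ract x (rip y z)"
    and lip_full: "closed_cspan {lip y z | y z. True} = UNIV"
    and rip_full: "closed_cspan {rip y z | y z. True} = UNIV"


section \<open>Strong Morita equivalence of inclusions\<close>

text \<open>
  The algebras \<open>C\<close>, \<open>D\<close> and the bimodule \<open>Y\<close> are the whole types \<open>'c\<close>, \<open>'d\<close> and \<open>'y\<close>; the
  subalgebras \<open>A\<close>, \<open>B\<close> and the subspace \<open>X\<close> are subsets of them.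
\<close>

locale strongly_morita_equivalent_inclusions =
  equivalence_bimodule lact ract lip rip
  for A :: "'c::cstar_algebra set" and B :: "'d::cstar_algebra set"
    and lact :: "'c \<Rightarrow> 'y::cbanach \<Rightarrow> 'y"
    and ract :: "'y \<Rightarrow> 'd \<Rightarrow> 'y"
    and lip :: "'y \<Rightarrow> 'y \<Rightarrow> 'c"
    and rip :: "'y \<Rightarrow> 'y \<Rightarrow> 'd"
    and X :: "'y set" +
  assumes csubspace_X: "csubspace X"
    and closed_X: "closed X"
    and lact_in_X: "a \<in> A \<Longrightarrow> x \<in> X \<Longrightarrow> lact a x \<in> X"
    and ract_in_X: "x \<in> X \<Longrightarrow> b \<in> B \<Longrightarrow> ract x b \<in> X"
    and lip_in_A: "x \<in> X \<Longrightarrow> z \<in> X \<Longrightarrow> lip x z \<in> A"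
    and rip_in_B: "x \<in> X \<Longrightarrow> z \<in> X \<Longrightarrow> rip x z \<in> B"
    and span_lip_XX: "closed_cspan {lip x z | x z. x \<in> X \<and> z \<in> X} = A"
    and span_rip_XX: "closed_cspan {rip x z | x z. x \<in> X \<and> z \<in> X} = B"
    and span_lip_YX: "closed_cspan {lip y x | y x. x \<in> X} = UNIV"
    and span_rip_YX: "closed_cspan {rip y x | y x. x \<in> X} = UNIV"

text \<open>
  The six identities relating \<open>\<phi>\<close>, \<open>\<psi>\<close> and \<open>\<tau>\<close>. The \<open>A\<close>- and \<open>B\<close>-valued inner products of \<open>X\<close> are
  the restrictions of \<open>lip\<close> and \<open>rip\<close>.
\<close>

definition transfer_identities ::
    "'c::cstar_algebra set \<Rightarrow> 'd::cstar_algebra set \<Rightarrow> ('c \<Rightarrow> 'y::cbanach \<Rightarrow> 'y) \<Rightarrow>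
     ('y \<Rightarrow> 'd \<Rightarrow> 'y) \<Rightarrow> ('y \<Rightarrow> 'y \<Rightarrow> 'c) \<Rightarrow> ('y \<Rightarrow> 'y \<Rightarrow> 'd) \<Rightarrow> 'y set \<Rightarrow>
     ('d \<Rightarrow> 'd) \<Rightarrow> ('c \<Rightarrow> 'c) \<Rightarrow> ('y \<Rightarrow> 'y) \<Rightarrow> bool"
  where "transfer_identities A B lact ract lip rip X \<phi> \<psi> \<tau> \<longleftrightarrow>
    (\<forall>c. \<forall>x\<in>X. \<tau> (lact c x) = lact (\<psi> c) x) \<and>
    (\<forall>a\<in>A. \<forall>y. \<tau> (lact a y) = lact a (\<tau> y)) \<and>
    (\<forall>y. \<forall>x\<in>X. lip (\<tau> y) x = \<psi> (lip y x)) \<and>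
    (\<forall>x\<in>X. \<forall>d. \<tau> (ract x d) = ract x (\<phi> d)) \<and>
    (\<forall>y. \<forall>b\<in>B. \<tau> (ract y b) = ract (\<tau> y) b) \<and>
    (\<forall>x\<in>X. \<forall>y. \<phi> (rip x y) = rip x (\<tau> y))"

end

theory Submission
  imports Defs
begin

text \<open>
  The map \<open>\<tau>\<close> is the only map with values in \<open>X\<close> that satisfies \<open>rip x (\<tau> y) = \<phi> (rip x y)\<close> for
  \<open>x \<in> X\<close>, because an element of \<open>X\<close> is determined by its inner products with \<open>X\<close>. On products it
  must be \<open>\<tau> (x d) = x \<phi>(d)\<close>, and wherever \<open>w = \<tau> y\<close> is available, taking \<open>x = w\<close> gives
  \<open>norm w ^ 2 = norm (\<phi> (rip w y)) \<le> onorm \<phi> * norm w * norm y\<close>. The graph of \<open>\<tau>\<close> is thus a closed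
  linear relation, bounded by \<open>onorm \<phi>\<close>, whose domain contains \<open>X D\<close>; since \<open>X D\<close> spans a dense
  subspace of \<open>Y\<close>, it is the graph of a map on all of \<open>Y\<close> (lemma
  \<open>bounded_closed_graph_total\<close>). In the same way \<open>\<psi> c\<close> is the element \<open>a \<in> A\<close> that acts on \<open>X\<close>
  as \<open>x \<mapsto> \<tau> (c x)\<close>. It exists for \<open>c = lip y x\<close>, where \<open>a = lip (\<tau> y) x\<close>, and the bound
  \<open>norm a \<le> onorm \<tau> * norm c\<close> holds because \<open>A\<close> acts isometrically on \<open>X\<close>. All identities and the
  uniqueness then follow from these two characterisations.

  Three facts about Hilbert modules carry the argument, and each is derived from the C*-identity
  alone, without spectral theory:
  \<^item> the Cauchy-Schwarz inequality (\<open>cauchy_schwarz\<close>): \<open>rip y w * rip w y = rip y (lip w w \<cdot> y)\<close>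
    turns any bound with a constant \<open>K\<close> into one with \<open>sqrt K\<close>, and iterating gives constant \<open>1\<close>;
  \<^item> \<open>A\<close> acts isometrically on \<open>X\<close> (\<open>norm_le_by_action_on_X\<close>): an estimate of \<open>star a * a\<close> up to a
    constant, uniform over its powers \<open>2 ^ k\<close>, becomes sharp after extracting roots;
  \<^item> \<open>y\<close> lies in the closure of \<open>g Y\<close> for \<open>g = lip y y\<close> (\<open>nondegenerate\<close>), from which density of
    \<open>X D\<close> follows: the operators \<open>1 + \<i> t g\<close> and \<open>1 - \<i> t g\<close> are mutually adjoint and commute, and a
    mean of products of \<open>N - 1\<close> of them is a polynomial in \<open>g\<close> with constant term \<open>1\<close> that almost
    annihilates \<open>y\<close>.

  The converse direction is the same theorem with left and right exchanged. Reading \<open>Y\<close> from right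
  to left turns it into a bimodule over the opposite algebras, so the development takes the
  multiplications as parameters and covers both directions with one proof.
\<close>

section \<open>Bounded linear relations between complex normed spaces\<close>

text \<open>Extracting \<open>2 ^ k\<close>-th roots removes constant factors from a family of estimates.\<close>

lemma le_if_power_bound:
  fixes a b \<delta> K :: real
  assumes "0 \<le> a" "0 \<le> b" "0 < \<delta>" and bound: "\<And>k::nat. a ^ (2 ^ k) * \<delta> \<le> K * b ^ (2 ^ k)"
  shows "a \<le> b"
proof (rule ccontr)
  assume "\<not> a \<le> b"
  then have ab: "b < a" by simp
  show False
  proof (cases "b = 0")
    case True
    then have "a * \<delta> \<le> 0" using bound[of 0] by simp
    then show False using ab True assms(3) by (simp add: mult_le_0_iff)
  next
    case False
    then have b: "0 < b" using assms by simp
    then have q: "1 < a / b" using ab by simp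
    then obtain n where n: "K / \<delta> < (a / b) ^ n" using real_arch_pow by blast
    have "(a / b) ^ n \<le> (a / b) ^ (2 ^ n)"
      using q by (intro power_increasing) (auto simp: less_imp_le)
    then have "K / \<delta> < a ^ (2 ^ n) / b ^ (2 ^ n)" using n by (simp add: power_divide)
    then show False using bound[of n] b assms(3) by (simp add: field_simps)
  qed
qed

lemma closed_cspan_subset:
  fixes T :: "'a::complex_normed_vector set"
  assumes "csubspace T" "closed T" "S \<subseteq> T"
  shows "closed_cspan S \<subseteq> T"
  unfolding closed_cspan_def
  using assms by (intro closure_minimal complex_vector.span_minimal)

lemma clinearI:
  assumes "\<And>x y. f (x + y) = f x + f y" "\<And>k x. f (k *\<^sub>C x) = k *\<^sub>C f x"
  shows "clinear f"
  using assms by (simp add: Vector_Spaces.linear_iff complex_vector.vector_space_axioms)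

lemma clinearD:
  assumes "clinear f"
  shows "f (x + y) = f x + f y" "f (k *\<^sub>C x) = k *\<^sub>C f x" "f (x - y) = f x - f y" "f 0 = 0"
proof -
  interpret f: Vector_Spaces.linear scaleC scaleC f by (fact assms)
  show "f (x + y) = f x + f y" "f (k *\<^sub>C x) = k *\<^sub>C f x" "f (x - y) = f x - f y" "f 0 = 0"
    by (rule f.add f.scale f.diff f.zero)+
qed

lemma bounded_clinear_bounded_linear:
  assumes "bounded_clinear f"
  shows "bounded_linear f"
proof -
  from assms obtain K where "clinear f" and K: "\<And>x. norm (f x) \<le> norm x * K"
    by (auto simp: bounded_clinear_def)
  then show ?thesis
    by (intro bounded_linear_intro[of f K]) (simp_all add: clinearD scaleR_scaleC)
qed

lemma bounded_clinearI:
  assumes "clinear f" "\<And>x. norm (f x) \<le> K * norm x"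
  shows "bounded_clinear f"
  using assms by (auto simp: bounded_clinear_def mult.commute)

lemma csubspace_closed_cspan:
  fixes S :: "'a::complex_normed_vector set"
  shows "csubspace (closed_cspan S)"
proof (rule complex_vector.subspaceI)
  show "0 \<in> closed_cspan S"
    unfolding closed_cspan_def using closure_subset complex_vector.span_zero by blast
next
  fix x y assume "x \<in> closed_cspan S" "y \<in> closed_cspan S"
  then obtain f g where "\<forall>n. f n \<in> cspan S" "f \<longlonglongrightarrow> x" "\<forall>n. g n \<in> cspan S" "g \<longlonglongrightarrow> y"
    unfolding closed_cspan_def closure_sequential by blast
  then show "x + y \<in> closed_cspan S"
    unfolding closed_cspan_def closure_sequential
    by (intro exI[of _ "\<lambda>n. f n + g n"]) (auto intro: tendsto_add complex_vector.span_add)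
next
  fix x k assume "x \<in> closed_cspan S"
  then obtain f where f: "\<forall>n. f n \<in> cspan S" "f \<longlonglongrightarrow> x"
    unfolding closed_cspan_def closure_sequential by blast
  have "bounded_linear (\<lambda>y::'a. k *\<^sub>C y)"
    by (intro bounded_clinear_bounded_linear bounded_clinearI[of _ "cmod k"] clinearI)
      (auto simp: scaleC_add_right scaleC_scaleC mult.commute norm_scaleC)
  then have "(\<lambda>n. k *\<^sub>C f n) \<longlonglongrightarrow> k *\<^sub>C x" using f(2) by (rule bounded_linear.tendsto)
  then show "k *\<^sub>C x \<in> closed_cspan S"
    unfolding closed_cspan_def closure_sequential
    using f(1) by (intro exI[of _ "\<lambda>n. k *\<^sub>C f n"]) (auto intro: complex_vector.span_scale)
qed

text \<open>
  A closed linear relation bounded by \<open>K\<close> is single-valued, and it has a closed domain because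
  Cauchy sequences of arguments have Cauchy sequences of values. Stating the extension principle
  for relations spares the check that a map prescribed on a spanning set is well defined.
\<close>

lemma bounded_closed_graph_total:
  fixes \<Gamma> :: "('u::complex_normed_vector \<times> 'v::cbanach) set"
  assumes add: "\<And>u v u' v'. (u, v) \<in> \<Gamma> \<Longrightarrow> (u', v') \<in> \<Gamma> \<Longrightarrow> (u + u', v + v') \<in> \<Gamma>"
    and scale: "\<And>u v k. (u, v) \<in> \<Gamma> \<Longrightarrow> (k *\<^sub>C u, k *\<^sub>C v) \<in> \<Gamma>"
    and closed: "closed \<Gamma>"
    and bound: "\<And>u v. (u, v) \<in> \<Gamma> \<Longrightarrow> norm v \<le> K * norm u"
    and zero: "(0, 0) \<in> \<Gamma>"
    and dense: "closed_cspan S = UNIV" and S: "S \<subseteq> fst ` \<Gamma>"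
  obtains f where "clinear f" "\<And>u v. (u, v) \<in> \<Gamma> \<longleftrightarrow> v = f u"
proof -
  have diff: "(u - u', v - v') \<in> \<Gamma>" if "(u, v) \<in> \<Gamma>" "(u', v') \<in> \<Gamma>" for u v u' v'
    using add[OF that(1) scale[OF that(2), of "-1"]]
    by (simp add: complex_vector.scale_minus_left scaleC_one)
  have unique: "v = v'" if "(u, v) \<in> \<Gamma>" "(u, v') \<in> \<Gamma>" for u v v'
    using bound[OF diff[OF that]] by simp
  have "closed (fst ` \<Gamma>)"
    unfolding closed_sequential_limits
  proof safe
    fix s u assume s: "\<forall>n. s n \<in> fst ` \<Gamma>" and lim: "s \<longlonglongrightarrow> u"
    from s have "\<forall>n. \<exists>v. (s n, v) \<in> \<Gamma>" by force
    then obtain r where r: "\<And>n. (s n, r n) \<in> \<Gamma>" by metis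
    have "Cauchy r"
    proof (rule metric_CauchyI)
      fix e :: real assume e: "0 < e"
      have "0 < e / (\<bar>K\<bar> + 1)" using e by simp
      then obtain M where M: "\<And>m n. m \<ge> M \<Longrightarrow> n \<ge> M \<Longrightarrow> dist (s m) (s n) < e / (\<bar>K\<bar> + 1)"
        using LIMSEQ_imp_Cauchy[OF lim] unfolding Cauchy_def by metis
      show "\<exists>M. \<forall>m\<ge>M. \<forall>n\<ge>M. dist (r m) (r n) < e"
      proof (intro exI allI impI)
        fix m n assume "M \<le> m" "M \<le> n"
        then have "norm (s m - s n) < e / (\<bar>K\<bar> + 1)" using M by (simp add: dist_norm)
        then have "norm (s m - s n) * (\<bar>K\<bar> + 1) < e" by (simp add: field_simps)
        moreover have "norm (r m - r n) \<le> K * norm (s m - s n)" by (rule bound[OF diff[OF r r]])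
        moreover have "K * norm (s m - s n) \<le> norm (s m - s n) * (\<bar>K\<bar> + 1)"
          by (subst mult.commute) (intro mult_left_mono, auto)
        ultimately show "dist (r m) (r n) < e" by (simp add: dist_norm)
      qed
    qed
    then obtain v where "r \<longlonglongrightarrow> v" using Cauchy_convergent convergent_def by blast
    then have "(\<lambda>n. (s n, r n)) \<longlonglongrightarrow> (u, v)" using lim by (intro tendsto_Pair)
    then have "(u, v) \<in> \<Gamma>"
      by (rule closed_sequentially[OF closed, rotated]) (rule r)
    then show "u \<in> fst ` \<Gamma>" by force
  qed
  moreover have "csubspace (fst ` \<Gamma>)"
    by (rule complex_vector.subspaceI) (use zero add scale in force)+
  ultimately have "fst ` \<Gamma> = UNIV" using closed_cspan_subset[of "fst ` \<Gamma>" S] dense S by auto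
  then have "\<forall>u. \<exists>v. (u, v) \<in> \<Gamma>" by (metis UNIV_I imageE prod.collapse)
  then obtain f where f: "\<And>u. (u, f u) \<in> \<Gamma>" by metis
  show thesis
  proof (rule that[of f])
    show "(u, v) \<in> \<Gamma> \<longleftrightarrow> v = f u" for u v using f unique by blast
    show "clinear f"
      by (rule clinearI) (blast intro: unique f add, blast intro: unique f scale)
  qed
qed

section \<open>Equivalence bimodules up to passage to opposite algebras\<close>

text \<open>
  What a C*-algebra and its opposite algebra have in common: star and norm are those of the type,
  while the multiplication is a parameter.
\<close>

locale cstar_product =
  fixes m :: "'a::cstar_algebra \<Rightarrow> 'a \<Rightarrow> 'a" (infixl "\<odot>" 70)
  assumes prod_assoc: "(x \<odot> y) \<odot> z = x \<odot> (y \<odot> z)"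
    and prod_add_left: "(x + y) \<odot> z = x \<odot> z + y \<odot> z"
    and prod_add_right: "x \<odot> (y + z) = x \<odot> y + x \<odot> z"
    and prod_scaleC_right: "x \<odot> (k *\<^sub>C y) = k *\<^sub>C (x \<odot> y)"
    and star_prod: "star (x \<odot> y) = star y \<odot> star x"
    and norm_prod_le: "norm (x \<odot> y) \<le> norm x * norm y"
    and norm_star_prod: "norm (star x \<odot> x) = (norm x)\<^sup>2"
begin

lemma prod_diff_right: "x \<odot> (y - z) = x \<odot> y - x \<odot> z"
  using prod_add_right[of x "y - z" z] by simp

end

lemma norm_star: "norm (star x) = norm (x :: 'a::cstar_algebra)"
proof -
  have le: "norm y \<le> norm (star y)" for y :: 'a
  proof (cases "y = 0")
    case False
    have "norm y * norm y \<le> norm (star y) * norm y"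
      using cstar_identity[of y] norm_mult_ineq[of "star y" y] by (simp add: power2_eq_square)
    then show ?thesis using False by simp
  qed simp
  show ?thesis using le[of x] le[of "star x"] by (simp add: star_star)
qed

lemma bounded_linear_star: "bounded_linear (star :: 'a::cstar_algebra \<Rightarrow> 'a)"
  by (rule bounded_linear_intro[where K = 1])
    (simp_all add: star_add norm_star scaleR_scaleC star_scaleC)

lemma star_zero: "star (0 :: 'a::cstar_algebra) = 0"
  using norm_star[of "0 :: 'a"] by simp

lemma closed_cspan_star_UNIV:
  assumes "closed_cspan (S :: 'a::cstar_algebra set) = UNIV"
  shows "closed_cspan (star ` S) = UNIV"
proof -
  let ?T = "{x. star x \<in> closed_cspan (star ` S)}"
  have "closed (star -` closed_cspan (star ` S))"
    by (rule closed_vimage[OF _ linear_continuous_on[OF bounded_linear_star]])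
      (simp add: closed_cspan_def)
  then have "closed ?T" by (simp add: vimage_def)
  moreover have "csubspace ?T"
    using csubspace_closed_cspan[of "star ` S"]
    by (intro complex_vector.subspaceI) (auto simp: star_zero star_add star_scaleC
      complex_vector.subspace_0 complex_vector.subspace_add complex_vector.subspace_scale)
  moreover have "S \<subseteq> ?T"
    unfolding closed_cspan_def
    by (auto intro!: subsetD[OF closure_subset] complex_vector.span_base)
  ultimately have "closed_cspan S \<subseteq> ?T" by (intro closed_cspan_subset)
  then have "star (star x) \<in> closed_cspan (star ` S)" for x
    unfolding assms by blast
  then show ?thesis by (auto simp: star_star)
qed

lemma cstar_product_times: "cstar_product ((*) :: 'a::cstar_algebra \<Rightarrow> 'a \<Rightarrow> 'a)"
  by unfold_locales
    (auto simp: algebra_simps mult_scaleC_right star_mult cstar_identity norm_mult_ineq)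

lemma cstar_product_opposite:
  assumes "cstar_product m"
  shows "cstar_product (\<lambda>x y. m y x)"
proof -
  interpret cstar_product m by (fact assms)
  have scale: "m (k *\<^sub>C x) y = k *\<^sub>C m x y" for k x y
  proof -
    have "star (m (k *\<^sub>C x) y) = star (k *\<^sub>C m x y)"
      by (simp add: star_prod star_scaleC prod_scaleC_right)
    then show ?thesis by (metis star_star)
  qed
  have "norm (m x (star x)) = (norm x)\<^sup>2" for x
    using norm_star_prod[of "star x"] by (simp add: star_star norm_star)
  then show ?thesis
    by unfold_locales
      (auto simp: prod_assoc prod_add_left prod_add_right scale star_prod
        intro: order_trans[OF norm_prod_le] simp: mult.commute)
qed

text \<open>
  Left and right axioms come in pairs, so that the list is invariant under exchanging the two sides
  and replacing both algebras by their opposites.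
\<close>

locale two_sided_module =
  mC: cstar_product mC + mD: cstar_product mD
  for mC :: "'c::cstar_algebra \<Rightarrow> 'c \<Rightarrow> 'c" (infixl "\<odot>\<^sub>C" 70)
    and mD :: "'d::cstar_algebra \<Rightarrow> 'd \<Rightarrow> 'd" (infixl "\<odot>\<^sub>D" 70) +
  fixes lact :: "'c \<Rightarrow> 'y::cbanach \<Rightarrow> 'y" and ract :: "'y \<Rightarrow> 'd \<Rightarrow> 'y"
    and lip :: "'y \<Rightarrow> 'y \<Rightarrow> 'c" and rip :: "'y \<Rightarrow> 'y \<Rightarrow> 'd"
  assumes lact_add_left: "lact (c + c') y = lact c y + lact c' y"
    and lact_add_right: "lact c (y + y') = lact c y + lact c y'"
    and lact_scaleC_left: "lact (k *\<^sub>C c) y = k *\<^sub>C lact c y"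
    and lact_scaleC_right: "lact c (k *\<^sub>C y) = k *\<^sub>C lact c y"
    and lact_mult: "lact (c \<odot>\<^sub>C c') y = lact c (lact c' y)"
    and lip_add_left: "lip (y + y') z = lip y z + lip y' z"
    and lip_scaleC_left: "lip (k *\<^sub>C y) z = k *\<^sub>C lip y z"
    and lip_lact: "lip (lact c y) z = c \<odot>\<^sub>C lip y z"
    and lip_star: "star (lip y z) = lip z y"
    and norm_lip: "norm (lip y y) = (norm y)\<^sup>2"
    and ract_add_left: "ract (y + y') d = ract y d + ract y' d"
    and ract_add_right: "ract y (d + d') = ract y d + ract y d'"
    and ract_scaleC_left: "ract (k *\<^sub>C y) d = k *\<^sub>C ract y d"
    and ract_scaleC_right: "ract y (k *\<^sub>C d) = k *\<^sub>C ract y d"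
    and ract_mult: "ract y (d \<odot>\<^sub>D d') = ract (ract y d) d'"
    and rip_add_right: "rip z (y + y') = rip z y + rip z y'"
    and rip_scaleC_right: "rip z (k *\<^sub>C y) = k *\<^sub>C rip z y"
    and rip_ract: "rip z (ract y d) = rip z y \<odot>\<^sub>D d"
    and rip_star: "star (rip y z) = rip z y"
    and norm_rip: "norm (rip y y) = (norm y)\<^sup>2"
    and lact_ract: "ract (lact c y) d = lact c (ract y d)"
    and rip_lact: "rip (lact c y) z = rip y (lact (star c) z)"
    and lip_ract: "lip (ract y d) z = lip y (ract z (star d))"
    and lip_rip: "lact (lip x y) z = ract x (rip y z)"
begin

text \<open>
  Over the opposite algebras no conjugate module is required: \<open>rip z y\<close> is linear in \<open>y\<close>, hence
  with its arguments exchanged it is linear in the first variable, as a left inner product must be.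
\<close>

lemma dual_module:
  "two_sided_module (\<lambda>x y. y \<odot>\<^sub>D x) (\<lambda>x y. y \<odot>\<^sub>C x)
     (\<lambda>d y. ract y d) (\<lambda>y c. lact c y) (\<lambda>y z. rip z y) (\<lambda>y z. lip z y)"
proof (intro two_sided_module.intro two_sided_module_axioms.intro)
  show "cstar_product (\<lambda>x y. y \<odot>\<^sub>D x)" "cstar_product (\<lambda>x y. y \<odot>\<^sub>C x)"
    by (rule cstar_product_opposite, rule mD.cstar_product_axioms mC.cstar_product_axioms)+
  show "rip z (lact d y) = rip (lact (star d) z) y" for y d z
    by (metis rip_lact star_star)
  show "lip z (ract y c) = lip (ract z (star c)) y" for y c z
    by (metis lip_ract star_star)
qed (rule ract_add_right ract_add_left ract_scaleC_right ract_scaleC_left ract_mult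
    rip_add_right rip_scaleC_right rip_ract rip_star norm_rip
    lact_add_right lact_add_left lact_scaleC_right lact_scaleC_left lact_mult
    lip_add_left lip_scaleC_left lip_lact lip_star norm_lip
    lact_ract[symmetric] lip_rip[symmetric])+

lemma rip_add_left: "rip (z + z') y = rip z y + rip z' y"
  by (metis rip_star rip_add_right star_add)

lemma rip_scaleC_left: "rip (k *\<^sub>C z) y = cnj k *\<^sub>C rip z y"
  by (metis rip_star rip_scaleC_right star_scaleC)

lemma rip_diff_right: "rip z (y - y') = rip z y - rip z y'"
  using rip_add_right[of z "y - y'" y'] by simp

lemma rip_zero_left: "rip 0 y = 0"
  using rip_add_left[of 0 0 y] by simp

lemma lact_diff_left: "lact (c - c') y = lact c y - lact c' y"
  using lact_add_left[of "c - c'" c' y] by simp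

lemma norm_lact_le: "norm (lact c y) \<le> norm c * norm y"
proof -
  have "lip y (lact c y) = star (c \<odot>\<^sub>C lip y y)" by (metis lip_lact lip_star)
  then have "(norm (lact c y))\<^sup>2 = norm (c \<odot>\<^sub>C star (c \<odot>\<^sub>C lip y y))"
    by (simp add: norm_lip[symmetric] lip_lact)
  also have "\<dots> \<le> norm c * norm (star (c \<odot>\<^sub>C lip y y))" by (rule mC.norm_prod_le)
  also have "\<dots> \<le> norm c * (norm c * (norm y)\<^sup>2)"
    unfolding norm_star norm_lip[symmetric] by (intro mult_left_mono mC.norm_prod_le) auto
  also have "\<dots> = (norm c * norm y)\<^sup>2" by (simp add: power2_eq_square)
  finally show ?thesis by (rule power2_le_imp_le) simp
qed

text \<open>
  Polarisation expresses \<open>rip w y\<close> through values of \<open>rip v v\<close>, whose norm is known; the constant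
  is irrelevant.
\<close>

lemma norm_rip_le_rough: "norm (rip w y) \<le> 6 * (norm w * norm y)"
proof (cases "w = 0 \<or> y = 0")
  case True
  moreover have "rip w 0 = 0" using rip_diff_right[of w 0 0] by simp
  ultimately have "rip w y = 0" using rip_zero_left by blast
  then show ?thesis by simp
next
  case False
  have unit: "norm (rip w y) \<le> 6" if w: "norm w = 1" and y: "norm y = 1" for w y
  proof -
    have e1: "rip (w + y) (w + y) = rip w w + rip w y + rip y w + rip y y"
      by (simp only: rip_add_left rip_add_right add_ac)
    have e2: "rip (w + \<i> *\<^sub>C y) (w + \<i> *\<^sub>C y) = rip w w + \<i> *\<^sub>C rip w y - \<i> *\<^sub>C rip y w + rip y y"
      by (simp add: rip_add_left rip_add_right rip_scaleC_left rip_scaleC_right scaleC_add_right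
          complex_vector.scale_right_diff_distrib scaleC_scaleC scaleC_one complex_vector.scale_minus_left)
    have polarize: "2 *\<^sub>C a = (s + a + b + s') - \<i> *\<^sub>C (s + \<i> *\<^sub>C a - \<i> *\<^sub>C b + s') - (1 - \<i>) *\<^sub>C (s + s')"
      for a b s s' :: 'd
    proof -
      have two: "2 *\<^sub>C a = a + a"
        using scaleC_add_left[of 1 1 a] by (simp add: scaleC_one)
      have i: "\<i> *\<^sub>C (s + \<i> *\<^sub>C a - \<i> *\<^sub>C b + s') = \<i> *\<^sub>C s - a + b + \<i> *\<^sub>C s'"
        by (simp add: complex_vector.scale_right_diff_distrib scaleC_add_right scaleC_scaleC
          scaleC_one complex_vector.scale_minus_left)
      have "(1 - \<i>) *\<^sub>C (s + s') = s + s' - (\<i> *\<^sub>C s + \<i> *\<^sub>C s')"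
        by (simp add: complex_vector.scale_left_diff_distrib scaleC_add_right scaleC_one)
      then show ?thesis unfolding two i by (simp add: algebra_simps)
    qed
    have "2 *\<^sub>C rip w y = rip (w + y) (w + y) - \<i> *\<^sub>C rip (w + \<i> *\<^sub>C y) (w + \<i> *\<^sub>C y)
        - (1 - \<i>) *\<^sub>C (rip w w + rip y y)"
      unfolding e1 e2 by (rule polarize)
    moreover have "norm (rip (w + y) (w + y)) \<le> 2\<^sup>2"
      unfolding norm_rip using norm_triangle_ineq[of w y] w y by (intro power_mono) auto
    moreover have "norm (\<i> *\<^sub>C rip (w + \<i> *\<^sub>C y) (w + \<i> *\<^sub>C y)) \<le> 2\<^sup>2"
    proof -
      have "norm (w + \<i> *\<^sub>C y) \<le> 2"
        using norm_triangle_ineq[of w "\<i> *\<^sub>C y"] w y by (simp add: norm_scaleC)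
      then have "(norm (w + \<i> *\<^sub>C y))\<^sup>2 \<le> 2\<^sup>2" by (rule power_mono) simp
      then show ?thesis by (simp add: norm_scaleC norm_rip)
    qed
    moreover have "norm ((1 - \<i>) *\<^sub>C (rip w w + rip y y)) \<le> 2 * 2"
      unfolding norm_scaleC
    proof (intro mult_mono)
      show "cmod (1 - \<i>) \<le> 2" using norm_triangle_ineq4[of 1 \<i>] by simp
      show "norm (rip w w + rip y y) \<le> 2"
        using norm_triangle_ineq[of "rip w w" "rip y y"] w y by (simp add: norm_rip)
    qed auto
    ultimately have "norm (2 *\<^sub>C rip w y) \<le> 2\<^sup>2 + 2\<^sup>2 + 2 * 2"
      by (simp only:) (rule order_trans[OF norm_triangle_ineq4 add_mono],
        rule order_trans[OF norm_triangle_ineq4 add_mono])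
    then show ?thesis by (simp add: norm_scaleC)
  qed
  let ?w = "complex_of_real (1 / norm w) *\<^sub>C w" and ?y = "complex_of_real (1 / norm y) *\<^sub>C y"
  have "norm (rip ?w ?y) \<le> 6"
    using False by (intro unit) (simp_all add: norm_scaleC norm_divide)
  then show ?thesis using False
    by (simp add: rip_scaleC_left rip_scaleC_right norm_scaleC norm_divide norm_mult field_simps)
qed

text \<open>
  The identity \<open>rip y w * rip w y = rip y (lip w w \<cdot> y)\<close> bounds the square of \<open>norm (rip w y)\<close> by
  an inner product of the same kind. Applying it \<open>k\<close> times leaves the rough constant in front of
  the \<open>2 ^ k\<close>-th powers, where it is negligible.
\<close>

lemma cauchy_schwarz: "norm (rip w y) \<le> norm w * norm y"
proof -
  have "norm (rip w y) ^ (2 ^ k) \<le> 6 * (norm w * norm y) ^ (2 ^ k)" for k w y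
  proof (induction k arbitrary: w y)
    case 0
    then show ?case using norm_rip_le_rough by simp
  next
    case (Suc k)
    have "(norm (rip w y))\<^sup>2 = norm (rip y (lact (lip w w) y))"
      by (simp add: mD.norm_star_prod[symmetric] rip_star rip_ract[symmetric] lip_rip)
    then have "norm (rip w y) ^ (2 ^ Suc k) = norm (rip y (lact (lip w w) y)) ^ (2 ^ k)"
      by (simp add: power_mult)
    also have "\<dots> \<le> 6 * (norm y * norm (lact (lip w w) y)) ^ (2 ^ k)" by (rule Suc.IH)
    also have "\<dots> \<le> 6 * (norm y * ((norm w)\<^sup>2 * norm y)) ^ (2 ^ k)"
      using norm_lact_le[of "lip w w" y]
      by (intro mult_left_mono power_mono) (auto simp: norm_lip)
    also have "norm y * ((norm w)\<^sup>2 * norm y) = (norm w * norm y)\<^sup>2" by (simp add: power2_eq_square)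
    finally show ?case by (simp add: power_mult)
  qed
  then show ?thesis by (intro le_if_power_bound[where \<delta> = 1 and K = 6, OF norm_ge_zero]) simp_all
qed

lemma norm_lip_le: "norm (lip w y) \<le> norm w * norm y"
  using two_sided_module.cauchy_schwarz[OF dual_module, of w y] by (simp add: mult.commute)

lemma bounded_linear_lact_left: "bounded_linear (\<lambda>c. lact c y)"
  by (intro bounded_clinear_bounded_linear bounded_clinearI[of _ "norm y"] clinearI)
    (simp_all add: lact_add_left lact_scaleC_left norm_lact_le mult.commute[of "norm y"])

lemma bounded_linear_rip_right: "bounded_linear (rip z)"
  by (intro bounded_clinear_bounded_linear bounded_clinearI[of _ "norm z"] clinearI)
    (auto simp: rip_add_right rip_scaleC_right cauchy_schwarz)

text \<open>
  This is the operator \<open>1 + \<i> t g\<close>. For self-adjoint \<open>g\<close> the quotient of \<open>1 + \<i> t g\<close> by its adjoint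
  \<open>1 - \<i> t g\<close> is the Cayley transform, a unitary. Working with numerator and denominator avoids
  inverses.
\<close>

definition cayley :: "real \<Rightarrow> 'c \<Rightarrow> 'y \<Rightarrow> 'y"
  where "cayley t g w = w + (\<i> * complex_of_real t) *\<^sub>C lact g w"

text \<open>
  Writing \<open>E = 1 + \<i> t g\<close> and \<open>F = 1 - \<i> t g\<close>, this is the sum of \<open>E ^ n * F ^ (N - 1 - n)\<close> over
  \<open>n < N\<close>, that is \<open>(E ^ N - F ^ N) / (E - F)\<close>.
\<close>

primrec cayley_sum :: "real \<Rightarrow> 'c \<Rightarrow> nat \<Rightarrow> 'y \<Rightarrow> 'y"
  where "cayley_sum t g 0 w = 0"
  | "cayley_sum t g (Suc N) w = cayley t g (cayley_sum t g N w) + (cayley (- t) g ^^ N) w"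

lemma cayley_add: "cayley t g (w + z) = cayley t g w + cayley t g z"
  by (simp add: cayley_def lact_add_right scaleC_add_right)

lemma cayley_commute: "cayley s g (cayley t g w) = cayley t g (cayley s g w)"
  by (simp add: cayley_def lact_add_right scaleC_add_right lact_scaleC_right scaleC_scaleC
      mult.commute add_ac)

lemma lact_cayley: "lact g (cayley t g w) = cayley t g (lact g w)"
  by (simp add: cayley_def lact_add_right lact_scaleC_right)

lemma ract_cayley: "ract (cayley t g w) d = cayley t g (ract w d)"
  by (simp add: cayley_def ract_add_left ract_scaleC_left lact_ract)

lemma cayley_funpow_commute:
  "cayley s g ((cayley t g ^^ N) w) = (cayley t g ^^ N) (cayley s g w)"
  by (induction N) (simp_all add: cayley_commute[of s])

lemma ract_cayley_funpow: "ract ((cayley t g ^^ N) w) d = (cayley t g ^^ N) (ract w d)"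
  by (induction N) (simp_all add: ract_cayley)

lemma lact_cayley_funpow: "lact g ((cayley t g ^^ N) w) = (cayley t g ^^ N) (lact g w)"
  by (induction N) (simp_all add: lact_cayley)

lemma cayley_sum_cayley: "cayley_sum t g N (cayley s g w) = cayley s g (cayley_sum t g N w)"
proof (induction N)
  case 0
  show ?case using cayley_add[of s g 0 0] by simp
qed (simp_all add: cayley_add cayley_commute[of s] cayley_funpow_commute)

lemma ract_cayley_sum: "ract (cayley_sum t g N w) d = cayley_sum t g N (ract w d)"
proof (induction N)
  case 0
  show ?case using ract_add_left[of 0 0] by simp
qed (simp_all add: ract_add_left ract_cayley ract_cayley_funpow)

lemma lact_cayley_sum: "lact g (cayley_sum t g N w) = cayley_sum t g N (lact g w)"
proof (induction N)
  case 0
  show ?case using lact_add_right[of g 0 0] by simp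
qed (simp_all add: lact_add_right lact_cayley lact_cayley_funpow)

lemma cayley_sum_telescope:
  "cayley t g (cayley_sum t g N w) - cayley (- t) g (cayley_sum t g N w) =
   (cayley t g ^^ N) w - (cayley (- t) g ^^ N) w"
proof (induction N)
  case 0
  show ?case using cayley_add[of t g 0 0] cayley_add[of "- t" g 0 0] by simp
next
  case (Suc N)
  let ?E = "cayley t g" and ?F = "cayley (- t) g" and ?R = "cayley_sum t g N w"
  have "?E (?R) = ?F ?R + ((?E ^^ N) w - (?F ^^ N) w)" using Suc by (simp add: algebra_simps)
  then have "?E (?E ?R) = ?E (?F ?R) + ?E ((?E ^^ N) w - (?F ^^ N) w)" by (metis cayley_add)
  also have "?E ((?E ^^ N) w - (?F ^^ N) w) = ?E ((?E ^^ N) w) - ?E ((?F ^^ N) w)"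
    by (metis add_diff_cancel cayley_add diff_add_cancel)
  finally show ?case
    by (simp add: cayley_add cayley_commute[of "- t" g t])
qed

context
  fixes g :: 'c
  assumes selfadjoint: "star g = g"
begin

lemma rip_cayley: "rip (cayley t g w) z = rip w (cayley (- t) g z)"
  by (simp add: cayley_def rip_add_left rip_add_right rip_diff_right rip_scaleC_left
      rip_scaleC_right rip_lact selfadjoint)

lemma rip_cayley_funpow: "rip ((cayley t g ^^ N) w) z = rip w ((cayley (- t) g ^^ N) z)"
  by (induction N arbitrary: w z) (simp_all add: rip_cayley cayley_funpow_commute)

text \<open>Taking adjoints exchanges \<open>E\<close> and \<open>F\<close>, and the sum is symmetric in them.\<close>

lemma rip_cayley_sum: "rip (cayley_sum t g N w) z = rip w (cayley_sum t g N z)"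
proof (induction N arbitrary: w z)
  case 0
  have "rip w 0 = 0" using rip_diff_right[of w 0 0] by simp
  then show ?case by (simp add: rip_zero_left)
next
  case (Suc N)
  have "rip (cayley_sum t g (Suc N) w) z =
      rip w (cayley (- t) g (cayley_sum t g N z) + (cayley t g ^^ N) z)"
    using rip_cayley_funpow[of N "- t" w z]
    by (simp add: rip_add_left rip_add_right rip_cayley Suc cayley_sum_cayley)
  also have "cayley (- t) g (cayley_sum t g N z) + (cayley t g ^^ N) z = cayley_sum t g (Suc N) z"
    using cayley_sum_telescope[of t g N z] by (simp add: algebra_simps)
  finally show ?case .
qed

text \<open>
  Since \<open>F E = 1 + t\<^sup>2 g\<^sup>2\<close>, the norm exceeds that of \<open>w\<close> only to second order in \<open>t\<close>: with \<open>t = 1 / sqrt N\<close>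
  the product of \<open>N\<close> factors stays bounded independently of \<open>N\<close>. The exponential form makes this
  bound explicit.
\<close>

lemma norm_cayley_le: "norm (cayley t g w) \<le> exp (t\<^sup>2 * (norm g)\<^sup>2) * norm w"
proof (rule power2_le_imp_le)
  have "(norm (cayley t g w))\<^sup>2 = norm (rip w (cayley (- t) g (cayley t g w)))"
    by (simp add: norm_rip[symmetric] rip_cayley)
  also have "cayley (- t) g (cayley t g w) = w + complex_of_real (t\<^sup>2) *\<^sub>C lact g (lact g w)"
    by (simp add: cayley_def lact_add_right lact_scaleC_right scaleC_add_right scaleC_scaleC
        complex_vector.scale_minus_left power2_eq_square algebra_simps)
  also have "norm (rip w \<dots>) \<le> norm w * norm (w + complex_of_real (t\<^sup>2) *\<^sub>C lact g (lact g w))"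
    by (rule cauchy_schwarz)
  also have "\<dots> \<le> norm w * (norm w + t\<^sup>2 * (norm g * (norm g * norm w)))"
  proof (intro mult_left_mono norm_triangle_ineq[THEN order_trans] add_mono)
    have "norm (lact g (lact g w)) \<le> norm g * (norm g * norm w)"
      by (intro norm_lact_le[THEN order_trans] mult_left_mono norm_lact_le) auto
    then show "norm (complex_of_real (t\<^sup>2) *\<^sub>C lact g (lact g w)) \<le> t\<^sup>2 * (norm g * (norm g * norm w))"
      unfolding norm_scaleC norm_of_real by (simp add: mult_left_mono)
  qed auto
  also have "\<dots> = (1 + t\<^sup>2 * (norm g)\<^sup>2) * (norm w)\<^sup>2" by (simp add: power2_eq_square algebra_simps)
  also have "\<dots> \<le> exp (t\<^sup>2 * (norm g)\<^sup>2) * (norm w)\<^sup>2"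
    by (intro mult_right_mono exp_ge_add_one_self) auto
  also have "\<dots> \<le> (exp (t\<^sup>2 * (norm g)\<^sup>2))\<^sup>2 * (norm w)\<^sup>2"
    by (intro mult_right_mono) (auto intro!: self_le_power)
  finally show "(norm (cayley t g w))\<^sup>2 \<le> (exp (t\<^sup>2 * (norm g)\<^sup>2) * norm w)\<^sup>2"
    by (simp add: power_mult_distrib)
qed auto

lemma norm_cayley_funpow_le:
  "norm ((cayley t g ^^ N) w) \<le> exp (t\<^sup>2 * (norm g)\<^sup>2) ^ N * norm w"
proof (induction N)
  case (Suc N)
  have "norm ((cayley t g ^^ Suc N) w) \<le> exp (t\<^sup>2 * (norm g)\<^sup>2) * norm ((cayley t g ^^ N) w)"
    using norm_cayley_le by simp
  also have "\<dots> \<le> exp (t\<^sup>2 * (norm g)\<^sup>2) * (exp (t\<^sup>2 * (norm g)\<^sup>2) ^ N * norm w)"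
    by (intro mult_left_mono Suc) auto
  finally show ?case by simp
qed simp

lemma norm_cayley_sum_le:
  "norm (cayley_sum t g N w) \<le> real N * (exp (t\<^sup>2 * (norm g)\<^sup>2) ^ N * norm w)"
proof (induction N)
  case (Suc N)
  let ?q = "exp (t\<^sup>2 * (norm g)\<^sup>2)"
  have q: "1 \<le> ?q" by simp
  have "norm (cayley_sum t g (Suc N) w) \<le>
      norm (cayley t g (cayley_sum t g N w)) + norm ((cayley (- t) g ^^ N) w)"
    by (simp add: norm_triangle_ineq)
  also have "\<dots> \<le> ?q * (real N * (?q ^ N * norm w)) + ?q ^ Suc N * norm w"
  proof (rule add_mono)
    show "norm (cayley t g (cayley_sum t g N w)) \<le> ?q * (real N * (?q ^ N * norm w))"
      by (rule norm_cayley_le[THEN order_trans]) (intro mult_left_mono Suc, simp)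
    have "norm ((cayley (- t) g ^^ N) w) \<le> ?q ^ N * norm w"
      using norm_cayley_funpow_le[of N "- t" w] by simp
    also have "\<dots> \<le> ?q ^ Suc N * norm w"
      using q by (intro mult_right_mono power_increasing) auto
    finally show "norm ((cayley (- t) g ^^ N) w) \<le> ?q ^ Suc N * norm w" .
  qed
  also have "\<dots> = real (Suc N) * (?q ^ Suc N * norm w)" by (simp add: algebra_simps)
  finally show ?case .
qed simp

end

text \<open>
  Let \<open>P\<close> be the cayley sum divided by \<open>N\<close>, with \<open>t = 1 / sqrt N\<close>. As a polynomial in \<open>g\<close> with constant
  term \<open>1\<close> it satisfies \<open>y - P y \<in> S\<close>, and telescoping gives \<open>2 \<i> t g P = (E ^ N - F ^ N) / N\<close>, so
  \<open>g P\<close> has norm of order \<open>1 / sqrt N\<close>. To pass from \<open>g P\<close> to \<open>u = P y\<close>, note that \<open>P\<close> is self-adjoint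
  and commutes with the right action, so that \<open>u (rip u u) = P (y (rip y (P u))) = g P (P u)\<close>,
  while the left-hand side has norm at least \<open>norm u ^ 3\<close>.
\<close>

lemma nondegenerate:
  assumes S: "csubspace S" "closed S" and act: "\<And>w. lact (lip y y) w \<in> S"
  shows "y \<in> S"
proof -
  define g where "g = lip y y"
  have sa: "star g = g" by (simp add: g_def lip_star)
  have gS: "k *\<^sub>C lact g w \<in> S" for k w
    using act S(1) by (auto simp: g_def intro: complex_vector.subspace_scale)
  have cayley_S: "cayley t g w - w \<in> S" for t w
    using gS by (simp add: cayley_def)
  have Sadd: "u + v \<in> S" if "u \<in> S" "v \<in> S" for u v
    using that S(1) by (rule complex_vector.subspace_add[rotated 1])
  have funpow_S: "(cayley t g ^^ N) w - w \<in> S" for t N w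
  proof (induction N)
    case 0
    show ?case using S(1) by (simp add: complex_vector.subspace_0)
  next
    case (Suc N)
    show ?case using Sadd[OF cayley_S[of t "(cayley t g ^^ N) w"] Suc] by simp
  qed
  have sum_S: "cayley_sum t g N w - of_nat N *\<^sub>C w \<in> S" for t N w
  proof (induction N)
    case 0
    show ?case using S(1) by (simp add: complex_vector.subspace_0)
  next
    case (Suc N)
    show ?case
      using Sadd[OF Sadd[OF cayley_S[of t "cayley_sum t g N w"] Suc] funpow_S[of N "- t" w]]
      by (simp add: scaleC_add_left scaleC_one algebra_simps)
  qed
  define K where "K = exp ((norm g)\<^sup>2)"
  have K: "0 < K" by (simp add: K_def)
  have approx: "\<exists>u. y - u \<in> S \<and> (norm u)\<^sup>2 \<le> K\<^sup>2 / sqrt (real N)" if N: "0 < N" for N :: nat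
  proof -
    define t where "t = 1 / sqrt (real N)"
    have t: "0 < t" "t\<^sup>2 = 1 / real N" using N by (simp_all add: t_def power_divide)
    have q: "exp (t\<^sup>2 * (norm g)\<^sup>2) ^ N = K"
      using N by (simp add: exp_of_nat_mult[symmetric] t K_def)
    define P where "P w = complex_of_real (1 / real N) *\<^sub>C cayley_sum t g N w" for w
    have P_ract: "ract (P w) d = P (ract w d)" for w d
      by (simp add: P_def ract_scaleC_left ract_cayley_sum)
    have P_rip: "rip (P w) z = rip w (P z)" for w z
      by (simp add: P_def rip_scaleC_left rip_scaleC_right rip_cayley_sum[OF sa])
    have P_le: "norm (P w) \<le> K * norm w" for w
      using norm_cayley_sum_le[OF sa, of t N w] N q
      by (simp add: P_def norm_scaleC norm_divide norm_mult field_simps)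
    have gP_le: "norm (lact g (P w)) \<le> K / sqrt (real N) * norm w" for w
    proof -
      let ?R = "cayley_sum t g N w"
      have "(2 * \<i> * complex_of_real t) *\<^sub>C lact g ?R =
          (\<i> * complex_of_real t) *\<^sub>C lact g ?R + (\<i> * complex_of_real t) *\<^sub>C lact g ?R"
        by (simp only: scaleC_add_left[symmetric]) simp
      also have "\<dots> = cayley t g ?R - cayley (- t) g ?R"
        by (simp add: cayley_def)
      also have "\<dots> = (cayley t g ^^ N) w - (cayley (- t) g ^^ N) w"
        by (rule cayley_sum_telescope)
      also have "norm \<dots> \<le> K * norm w + K * norm w"
        using norm_cayley_funpow_le[OF sa, of N t w] norm_cayley_funpow_le[OF sa, of N "- t" w] q
        by (intro norm_triangle_ineq4[THEN order_trans] add_mono) simp_all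
      finally have "t * norm (lact g ?R) \<le> K * norm w"
        using t by (simp add: norm_scaleC norm_mult)
      then have "norm (lact g ?R) / real N \<le> (K * norm w / t) / real N"
        using t(1) by (intro divide_right_mono) (simp_all add: field_simps)
      also have "(K * norm w / t) / real N = K / sqrt (real N) * norm w"
        using N by (simp add: t_def field_simps)
      finally show ?thesis
        by (simp add: P_def lact_scaleC_right norm_scaleC norm_divide)
    qed
    define u where "u = P y"
    have "y - u = complex_of_real (- 1 / real N) *\<^sub>C (cayley_sum t g N y - of_nat N *\<^sub>C y)"
      using N by (simp add: u_def P_def complex_vector.scale_right_diff_distrib scaleC_scaleC
          scaleC_one complex_vector.scale_minus_left)
    then have yu: "y - u \<in> S" using sum_S S(1)
      by (simp only: complex_vector.subspace_scale)
    have "ract u (rip u u) = lact g (P (P u))"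
    proof -
      have "ract u (rip u u) = P (ract y (rip y (P u)))"
        using P_ract[of y "rip u u"] P_rip[of y u] by (simp add: u_def)
      also have "ract y (rip y (P u)) = lact g (P u)" by (simp add: g_def lip_rip)
      also have "P (lact g (P u)) = lact g (P (P u))"
        by (simp add: P_def lact_scaleC_right lact_cayley_sum)
      finally show ?thesis .
    qed
    then have "norm (ract u (rip u u)) \<le> K / sqrt (real N) * norm (P u)"
      using gP_le by simp
    also have "\<dots> \<le> K / sqrt (real N) * (K * norm u)"
      using P_le K by (intro mult_left_mono) auto
    finally have cube: "norm (ract u (rip u u)) \<le> K\<^sup>2 / sqrt (real N) * norm u"
      by (simp add: power2_eq_square)
    have "(norm u)\<^sup>2 * (norm u)\<^sup>2 = norm (rip u (ract u (rip u u)))"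
      using mD.norm_star_prod[of "rip u u"]
      by (simp add: rip_star rip_ract norm_rip power2_eq_square)
    also have "\<dots> \<le> norm u * (K\<^sup>2 / sqrt (real N) * norm u)"
      by (intro cauchy_schwarz[THEN order_trans] mult_left_mono cube) auto
    finally have "(norm u)\<^sup>2 * (norm u)\<^sup>2 \<le> (K\<^sup>2 / sqrt (real N)) * (norm u)\<^sup>2"
      by (simp add: power2_eq_square mult_ac)
    then have "(norm u)\<^sup>2 \<le> K\<^sup>2 / sqrt (real N)"
    proof (cases "u = 0")
      case False
      then have "0 < (norm u)\<^sup>2" by simp
      with \<open>(norm u)\<^sup>2 * (norm u)\<^sup>2 \<le> _\<close> show ?thesis by (rule mult_right_le_imp_le)
    qed simp
    then show ?thesis using yu by blast
  qed
  then have "\<forall>n. \<exists>u. y - u \<in> S \<and> (norm u)\<^sup>2 \<le> K\<^sup>2 / sqrt (real (Suc n))" by blast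
  then obtain u where u: "\<And>n. y - u n \<in> S" "\<And>n. (norm (u n))\<^sup>2 \<le> K\<^sup>2 / sqrt (real (Suc n))"
    by metis
  have "(\<lambda>n. K\<^sup>2 * sqrt (inverse (real (Suc n)))) \<longlonglongrightarrow> K\<^sup>2 * sqrt 0"
    by (intro tendsto_mult_left tendsto_real_sqrt LIMSEQ_inverse_real_of_nat)
  then have lim: "(\<lambda>n. K\<^sup>2 / sqrt (real (Suc n))) \<longlonglongrightarrow> 0"
    by (simp add: real_sqrt_inverse divide_inverse)
  have "(\<lambda>n. (norm (u n))\<^sup>2) \<longlonglongrightarrow> 0"
    by (rule tendsto_sandwich[OF _ _ tendsto_const lim]) (use u(2) in simp_all)
  then have "(\<lambda>n. sqrt ((norm (u n))\<^sup>2)) \<longlonglongrightarrow> sqrt 0" by (rule tendsto_real_sqrt)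
  then have "u \<longlonglongrightarrow> 0" by (simp add: tendsto_norm_zero_iff)
  then have "(\<lambda>n. y - u n) \<longlonglongrightarrow> y - 0" by (intro tendsto_intros)
  then show ?thesis using u(1) S(2) unfolding closed_sequential_limits by force
qed

end

section \<open>Transferring a bimodule map\<close>

text \<open>
  Passing to the opposite multiplication only swaps the two identities, so that an algebra and its
  opposite have the same bimodule maps.
\<close>

definition bimodule_maps_over ::
    "('c::cstar_algebra \<Rightarrow> 'c \<Rightarrow> 'c) \<Rightarrow> 'c set \<Rightarrow> ('c \<Rightarrow> 'c) set"
  where "bimodule_maps_over m A = {\<psi>. bounded_clinear \<psi> \<and> range \<psi> \<subseteq> A \<and>
    (\<forall>a\<in>A. \<forall>c. \<psi> (m a c) = m a (\<psi> c) \<and> \<psi> (m c a) = m (\<psi> c) a)}"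

locale inclusion_module =
  two_sided_module mC mD lact ract lip rip
  for mC :: "'c::cstar_algebra \<Rightarrow> 'c \<Rightarrow> 'c" (infixl "\<odot>\<^sub>C" 70)
    and mD :: "'d::cstar_algebra \<Rightarrow> 'd \<Rightarrow> 'd" (infixl "\<odot>\<^sub>D" 70)
    and lact :: "'c \<Rightarrow> 'y::cbanach \<Rightarrow> 'y" and ract :: "'y \<Rightarrow> 'd \<Rightarrow> 'y"
    and lip :: "'y \<Rightarrow> 'y \<Rightarrow> 'c" and rip :: "'y \<Rightarrow> 'y \<Rightarrow> 'd" +
  fixes A :: "'c set" and B :: "'d set" and X :: "'y set"
  assumes csubspace_A: "csubspace A" and closed_A: "closed A"
    and prod_in_A: "a \<in> A \<Longrightarrow> a' \<in> A \<Longrightarrow> a \<odot>\<^sub>C a' \<in> A" and star_in_A: "a \<in> A \<Longrightarrow> star a \<in> A"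
    and csubspace_B: "csubspace B" and closed_B: "closed B"
    and prod_in_B: "b \<in> B \<Longrightarrow> b' \<in> B \<Longrightarrow> b \<odot>\<^sub>D b' \<in> B" and star_in_B: "b \<in> B \<Longrightarrow> star b \<in> B"
    and csubspace_X: "csubspace X" and closed_X: "closed X"
    and lact_in_X: "a \<in> A \<Longrightarrow> x \<in> X \<Longrightarrow> lact a x \<in> X"
    and ract_in_X: "x \<in> X \<Longrightarrow> b \<in> B \<Longrightarrow> ract x b \<in> X"
    and lip_in_A: "x \<in> X \<Longrightarrow> z \<in> X \<Longrightarrow> lip x z \<in> A"
    and rip_in_B: "x \<in> X \<Longrightarrow> z \<in> X \<Longrightarrow> rip x z \<in> B"
    and span_lip_XX: "A \<subseteq> closed_cspan {lip x z | x z. x \<in> X \<and> z \<in> X}"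
    and span_rip_XX: "B \<subseteq> closed_cspan {rip x z | x z. x \<in> X \<and> z \<in> X}"
    and span_lip_YX: "closed_cspan {lip y x | y x. x \<in> X} = UNIV"
    and span_rip_XY: "closed_cspan {rip x y | x y. x \<in> X} = UNIV"
begin

lemma dual_inclusion:
  "inclusion_module (\<lambda>x y. y \<odot>\<^sub>D x) (\<lambda>x y. y \<odot>\<^sub>C x)
     (\<lambda>d y. ract y d) (\<lambda>y c. lact c y) (\<lambda>y z. rip z y) (\<lambda>y z. lip z y) B A X"
proof -
  have swap: "{rip z x | x z. x \<in> X \<and> z \<in> X} = {rip x z | x z. x \<in> X \<and> z \<in> X}"
    "{lip z x | x z. x \<in> X \<and> z \<in> X} = {lip x z | x z. x \<in> X \<and> z \<in> X}"
    "{rip x y | y x. x \<in> X} = {rip x y | x y. x \<in> X}"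
    "{lip y x | x y. x \<in> X} = {lip y x | y x. x \<in> X}"
    by blast+
  show ?thesis
    by (intro inclusion_module.intro inclusion_module_axioms.intro dual_module; (unfold swap)?)
      (rule csubspace_A closed_A prod_in_A star_in_A csubspace_B closed_B prod_in_B star_in_B
        csubspace_X closed_X lact_in_X ract_in_X lip_in_A rip_in_B
        span_lip_XX span_rip_XX span_lip_YX span_rip_XY; assumption)+
qed

text \<open>
  Put \<open>h = star a * a\<close>, which acts on \<open>X\<close> with norm at most
  \<open>L\<^sup>2\<close>. For \<open>u\<close> in the span of the inner products of \<open>X\<close> the norm of \<open>h ^ (2 ^ k) * u\<close> is at most a
  constant times \<open>(L\<^sup>2) ^ (2 ^ k)\<close>, because \<open>h ^ n * lip x z\<close> is the inner product of \<open>h ^ n \<cdot> x\<close> and \<open>z\<close>.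
  Such \<open>u\<close> approximate \<open>h\<close>, and by the C*-identity the norm of \<open>h ^ (2 ^ k) * h\<close> is the corresponding
  power of \<open>norm h\<close>; comparing growth rates gives \<open>norm h \<le> L\<^sup>2\<close>.
\<close>

lemma norm_le_by_action_on_X:
  assumes a: "a \<in> A" and L: "0 \<le> L" and act: "\<And>x. x \<in> X \<Longrightarrow> norm (lact a x) \<le> L * norm x"
  shows "norm a \<le> L"
proof -
  define h where "h = star a \<odot>\<^sub>C a"
  \<comment> \<open>\<open>sq k\<close> is \<open>h ^ (2 ^ k)\<close>, written by repeated squaring for the multiplication at hand.\<close>
  define sq where "sq k = ((\<lambda>g. g \<odot>\<^sub>C g) ^^ k) h" for k
  have sq_0: "sq 0 = h" and sq_Suc: "sq (Suc k) = sq k \<odot>\<^sub>C sq k" for k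
    by (simp_all add: sq_def)
  have h: "h \<in> A" "star h = h" "norm h = (norm a)\<^sup>2"
    using a by (auto simp: h_def prod_in_A star_in_A mC.star_prod star_star mC.norm_star_prod)
  have act_star: "norm (lact (star a) x) \<le> L * norm x" if x: "x \<in> X" for x
  proof -
    let ?v = "lact (star a) x"
    have "?v \<in> X" using x a by (simp add: lact_in_X star_in_A)
    have "(norm ?v)\<^sup>2 = norm (rip x (lact a ?v))"
      by (simp add: norm_rip[symmetric] rip_lact star_star)
    also have "\<dots> \<le> norm x * (L * norm ?v)"
      by (intro cauchy_schwarz[THEN order_trans] mult_left_mono act \<open>?v \<in> X\<close>) auto
    finally have "norm ?v * norm ?v \<le> (L * norm x) * norm ?v"
      by (simp add: power2_eq_square mult_ac)
    then show ?thesis using L by (cases "?v = 0") auto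
  qed
  have double: "r ^ (2 * 2 ^ k) = r ^ (2 ^ k) * r ^ (2 ^ k)" for r :: real and k :: nat
    by (simp only: mult_2 power_add)
  have sq_A: "sq k \<in> A" for k
    by (induction k) (simp_all add: sq_0 sq_Suc h prod_in_A)
  have sq_star: "star (sq k) = sq k" for k
    by (induction k) (simp_all add: sq_0 sq_Suc h mC.star_prod)
  have sq_norm: "norm (sq k) \<le> norm h ^ (2 ^ k)" for k
  proof (induction k)
    case (Suc k)
    have "norm (sq (Suc k)) \<le> norm (sq k) * norm (sq k)"
      unfolding sq_Suc by (rule mC.norm_prod_le)
    also have "\<dots> \<le> norm h ^ (2 ^ k) * norm h ^ (2 ^ k)" by (intro mult_mono Suc) auto
    finally show ?case by (simp add: double)
  qed (simp add: sq_0)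
  have sq_act: "norm (lact (sq k) x) \<le> (L\<^sup>2) ^ (2 ^ k) * norm x" if "x \<in> X" for k x
    using that
  proof (induction k arbitrary: x)
    case 0
    have "norm (lact h x) \<le> L * norm (lact a x)"
      unfolding h_def lact_mult by (intro act_star lact_in_X a 0)
    also have "\<dots> \<le> L * (L * norm x)" by (intro mult_left_mono act 0 L)
    finally show ?case by (simp add: sq_0 power2_eq_square)
  next
    case (Suc k)
    have "norm (lact (sq (Suc k)) x) \<le> (L\<^sup>2) ^ (2 ^ k) * norm (lact (sq k) x)"
      unfolding sq_Suc lact_mult by (intro Suc.IH lact_in_X sq_A Suc.prems)
    also have "\<dots> \<le> (L\<^sup>2) ^ (2 ^ k) * ((L\<^sup>2) ^ (2 ^ k) * norm x)"
      by (intro mult_left_mono Suc.IH Suc.prems) auto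
    finally show ?case by (simp add: double mult.assoc)
  qed
  have sq_lower: "norm h ^ (2 ^ k) * norm h \<le> norm (sq k \<odot>\<^sub>C h)" for k
  proof (induction k)
    case 0
    show ?case using mC.norm_star_prod[of h] by (simp add: sq_0 h power2_eq_square)
  next
    case (Suc k)
    have "(norm h ^ (2 ^ k) * norm h)\<^sup>2 \<le> (norm (sq k \<odot>\<^sub>C h))\<^sup>2"
      by (intro power_mono Suc) auto
    also have "\<dots> = norm (h \<odot>\<^sub>C (sq (Suc k) \<odot>\<^sub>C h))"
      by (simp add: mC.norm_star_prod[symmetric] mC.star_prod h sq_star sq_Suc mC.prod_assoc)
    also have "\<dots> \<le> norm h * norm (sq (Suc k) \<odot>\<^sub>C h)" by (rule mC.norm_prod_le)
    finally have "norm h * (norm h ^ (2 ^ Suc k) * norm h) \<le> norm h * norm (sq (Suc k) \<odot>\<^sub>C h)"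
      by (simp add: power2_eq_square mult_ac double)
    then show ?case by (cases "h = 0") auto
  qed
  have upper: "\<exists>K. \<forall>k. norm (sq k \<odot>\<^sub>C u) \<le> K * (L\<^sup>2) ^ (2 ^ k)"
    if "u \<in> cspan {lip x z | x z. x \<in> X \<and> z \<in> X}" for u
    using that
  proof (induction u rule: complex_vector.span_induct_alt)
    case base
    have "sq k \<odot>\<^sub>C 0 = 0" for k using mC.prod_diff_right[of "sq k" 0 0] by simp
    then show ?case by (intro exI[of _ 0]) simp
  next
    case (step c v u)
    then obtain x z K where v: "v = lip x z" "x \<in> X"
      and K: "\<And>k. norm (sq k \<odot>\<^sub>C u) \<le> K * (L\<^sup>2) ^ (2 ^ k)" by blast
    show ?case
    proof (intro exI allI)
      fix k
      have "norm (sq k \<odot>\<^sub>C lip x z) \<le> norm (lact (sq k) x) * norm z"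
        by (simp add: lip_lact[symmetric] norm_lip_le)
      also have "\<dots> \<le> (L\<^sup>2) ^ (2 ^ k) * norm x * norm z"
        by (intro mult_right_mono sq_act v(2)) auto
      finally have "cmod c * norm (sq k \<odot>\<^sub>C lip x z) \<le> cmod c * ((L\<^sup>2) ^ (2 ^ k) * norm x * norm z)"
        by (rule mult_left_mono) auto
      then have "norm (sq k \<odot>\<^sub>C (c *\<^sub>C v + u)) \<le>
          cmod c * ((L\<^sup>2) ^ (2 ^ k) * norm x * norm z) + K * (L\<^sup>2) ^ (2 ^ k)"
        using K[of k] unfolding v(1) mC.prod_add_right mC.prod_scaleC_right
        by (intro norm_triangle_le add_mono) (simp_all add: norm_scaleC)
      then show "norm (sq k \<odot>\<^sub>C (c *\<^sub>C v + u)) \<le>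
          (cmod c * norm x * norm z + K) * (L\<^sup>2) ^ (2 ^ k)"
        by (simp add: algebra_simps)
    qed
  qed
  have "norm h \<le> L\<^sup>2"
  proof (cases "h = 0")
    case False
    then have pos: "0 < norm h / 2" by simp
    have "h \<in> closure (cspan {lip x z | x z. x \<in> X \<and> z \<in> X})"
      using h(1) span_lip_XX unfolding closed_cspan_def by blast
    then obtain u where u: "u \<in> cspan {lip x z | x z. x \<in> X \<and> z \<in> X}"
      and "dist u h < norm h / 2"
      using pos unfolding closure_approachable by blast
    then have close: "norm (h - u) \<le> norm h / 2"
      by (simp add: dist_norm norm_minus_commute)
    from upper[OF u] obtain K where K: "\<And>k. norm (sq k \<odot>\<^sub>C u) \<le> K * (L\<^sup>2) ^ (2 ^ k)" by blast
    \<comment> \<open>Half of the lower bound for \<open>sq k * h\<close> survives replacing \<open>h\<close> by \<open>u\<close>.\<close>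
    have "norm h ^ (2 ^ k) * (norm h / 2) \<le> K * (L\<^sup>2) ^ (2 ^ k)" for k
    proof -
      have "norm (sq k \<odot>\<^sub>C (h - u)) \<le> norm h ^ (2 ^ k) * (norm h / 2)"
        by (intro mC.norm_prod_le[THEN order_trans] mult_mono sq_norm close) auto
      moreover have "norm (sq k \<odot>\<^sub>C h) \<le> norm (sq k \<odot>\<^sub>C u) + norm (sq k \<odot>\<^sub>C (h - u))"
        using norm_triangle_ineq[of "sq k \<odot>\<^sub>C u" "sq k \<odot>\<^sub>C (h - u)"]
        by (simp add: mC.prod_diff_right)
      ultimately show ?thesis using K[of k] sq_lower[of k] by (simp add: field_simps)
    qed
    then show ?thesis
      by (intro le_if_power_bound[where \<delta> = "norm h / 2" and K = K, OF norm_ge_zero]) (use pos in auto)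
  qed simp
  then show ?thesis unfolding h(3) using L by (rule power2_le_imp_le)
qed

text \<open>
  Adjoints of the spanning elements \<open>lip y x\<close> of \<open>C\<close> are \<open>lip x y\<close>, and \<open>lip x y \<cdot> w = x (rip y w)\<close> is a
  product of the required form. Hence the closed span of \<open>X D\<close> contains \<open>C Y\<close>, and nondegeneracy
  of the left action does the rest.
\<close>

lemma span_ract_XD: "closed_cspan {ract x d | x d. x \<in> X} = UNIV"
proof -
  define S where "S = closed_cspan {ract x d | x d. x \<in> X}"
  have S: "csubspace S" "closed S"
    by (simp_all add: S_def csubspace_closed_cspan) (simp add: closed_cspan_def)
  have in_S: "ract x d \<in> S" if "x \<in> X" for x d
    unfolding S_def closed_cspan_def
    by (rule subsetD[OF closure_subset], rule complex_vector.span_base) (use that in blast)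
  have "lact c w \<in> S" for c w
  proof -
    let ?T = "{c. lact (star c) w \<in> S}"
    have "bounded_linear (\<lambda>c. lact (star c) w)"
      by (rule bounded_linear_compose[OF bounded_linear_lact_left bounded_linear_star])
    then have "closed ((\<lambda>c. lact (star c) w) -` S)"
      by (rule closed_vimage[OF S(2) linear_continuous_on])
    then have "closed ?T" by (simp add: vimage_def)
    moreover have "csubspace ?T"
    proof (rule complex_vector.subspaceI)
      have "lact (star 0) w = 0" using lact_diff_left[of 0 0 w] by (simp add: star_zero)
      then show "0 \<in> ?T" using S(1) by (simp add: complex_vector.subspace_0)
    qed (use S(1) in \<open>auto simp: star_add star_scaleC lact_add_left lact_scaleC_left
        complex_vector.subspace_add complex_vector.subspace_scale\<close>)
    moreover have "{lip y x | y x. x \<in> X} \<subseteq> ?T"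
      by (auto simp: lip_star lip_rip in_S)
    ultimately have "closed_cspan {lip y x | y x. x \<in> X} \<subseteq> ?T"
      by (intro closed_cspan_subset)
    then have "star c \<in> ?T" unfolding span_lip_YX by blast
    then show ?thesis by (simp add: star_star)
  qed
  then have "y \<in> S" for y
    by (rule nondegenerate[OF S])
  then show ?thesis by (auto simp: S_def)
qed

definition transfers :: "('d \<Rightarrow> 'd) \<Rightarrow> ('c \<Rightarrow> 'c) \<Rightarrow> ('y \<Rightarrow> 'y) \<Rightarrow> bool"
  where "transfers \<phi> \<psi> \<tau> \<longleftrightarrow> clinear \<tau> \<and> range \<tau> \<subseteq> X \<and> \<psi> \<in> bimodule_maps_over mC A \<and>
    transfer_identities A B lact ract lip rip X \<phi> \<psi> \<tau>"

lemma transfer_norm_bound: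
  assumes \<phi>: "\<phi> \<in> bimodule_maps_over mD B" and w: "w \<in> X" "\<And>x. x \<in> X \<Longrightarrow> rip x w = \<phi> (rip x y)"
  shows "norm w \<le> onorm \<phi> * norm y"
proof -
  have bl: "bounded_linear \<phi>"
    using \<phi> by (simp add: bimodule_maps_over_def bounded_clinear_bounded_linear)
  have "(norm w)\<^sup>2 = norm (\<phi> (rip w y))" using w by (simp add: norm_rip[symmetric])
  also have "\<dots> \<le> onorm \<phi> * norm (rip w y)" by (rule onorm[OF bl])
  also have "\<dots> \<le> onorm \<phi> * (norm w * norm y)"
    by (intro mult_left_mono cauchy_schwarz onorm_pos_le[OF bl])
  finally have "norm w * norm w \<le> (onorm \<phi> * norm y) * norm w"
    by (simp add: power2_eq_square mult_ac)
  then show ?thesis using onorm_pos_le[OF bl] by (cases "w = 0") auto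
qed

text \<open>
  The relation defined by the right-hand side of the equivalence relates \<open>x d\<close> to \<open>x \<phi>(d)\<close>, so its
  domain is dense.
\<close>

lemma ex_transfer_map:
  assumes \<phi>: "\<phi> \<in> bimodule_maps_over mD B"
  obtains \<tau> where "clinear \<tau>"
    "\<And>y w. w = \<tau> y \<longleftrightarrow> w \<in> X \<and> (\<forall>x\<in>X. rip x w = \<phi> (rip x y))"
proof -
  have cl: "clinear \<phi>" and bl: "bounded_linear \<phi>" and ran: "\<And>d. \<phi> d \<in> B"
    and bimod: "\<And>b d. b \<in> B \<Longrightarrow> \<phi> (b \<odot>\<^sub>D d) = b \<odot>\<^sub>D \<phi> d"
    using \<phi> by (auto simp: bimodule_maps_over_def bounded_clinear_bounded_linear bounded_clinear_def)
  define \<Gamma> where "\<Gamma> = {(y, w). w \<in> X \<and> (\<forall>x\<in>X. rip x w = \<phi> (rip x y))}"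
  have zero: "rip x 0 = 0" for x using rip_diff_right[of x 0 0] by simp
  have closed: "closed \<Gamma>"
  proof -
    have "\<Gamma> = snd -` X \<inter> (\<Inter>x\<in>X. {p. rip x (snd p) = \<phi> (rip x (fst p))})"
      by (auto simp: \<Gamma>_def)
    moreover have "closed (snd -` X :: ('y \<times> 'y) set)"
      by (intro closed_vimage_snd closed_X)
    moreover have "closed {p. rip x (snd p) = \<phi> (rip x (fst p))}" for x
      by (intro closed_Collect_eq linear_continuous_on)
        (rule bounded_linear_compose[OF bounded_linear_rip_right bounded_linear_snd]
          bounded_linear_compose[OF bl bounded_linear_compose[OF bounded_linear_rip_right bounded_linear_fst]])+
    ultimately show ?thesis by (simp add: closed_Int closed_INT)
  qed
  have dom: "{ract x d | x d. x \<in> X} \<subseteq> fst ` \<Gamma>"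
  proof safe
    fix x d assume "x \<in> X"
    then have "(ract x d, ract x (\<phi> d)) \<in> \<Gamma>"
      by (simp add: \<Gamma>_def ract_in_X ran rip_ract bimod rip_in_B)
    then show "ract x d \<in> fst ` \<Gamma>" by force
  qed
  have bound: "norm w \<le> onorm \<phi> * norm y" if "(y, w) \<in> \<Gamma>" for y w
    using that transfer_norm_bound[OF \<phi>] by (auto simp: \<Gamma>_def)
  have add: "(u + u', v + v') \<in> \<Gamma>" if "(u, v) \<in> \<Gamma>" "(u', v') \<in> \<Gamma>" for u v u' v'
    using that csubspace_X by (auto simp: \<Gamma>_def rip_add_right rip_scaleC_right clinearD[OF cl]
        complex_vector.subspace_add)
  have scale: "(k *\<^sub>C u, k *\<^sub>C v) \<in> \<Gamma>" if "(u, v) \<in> \<Gamma>" for u v k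
    using that csubspace_X by (auto simp: \<Gamma>_def rip_add_right rip_scaleC_right clinearD[OF cl]
        complex_vector.subspace_scale)
  have "(0, 0) \<in> \<Gamma>"
    using csubspace_X by (auto simp: \<Gamma>_def zero clinearD[OF cl] complex_vector.subspace_0)
  then obtain \<tau> where \<tau>: "clinear \<tau>" "\<And>u v. (u, v) \<in> \<Gamma> \<longleftrightarrow> v = \<tau> u"
    using bounded_closed_graph_total[OF add scale closed bound _ span_ract_XD dom] by blast
  then show thesis by (intro that[of \<tau>]) (auto simp: \<Gamma>_def)
qed

text \<open>
  Here \<open>lip y x\<close> is related to \<open>lip (\<tau> y) x\<close>: both sides send \<open>z \<in> X\<close> to \<open>\<tau> y \<cdot> rip x z\<close>, as
  \<open>\<tau>\<close> commutes with \<open>B\<close>. Boundedness of the relation is the isometry of the action of \<open>A\<close> on \<open>X\<close>.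
\<close>

lemma ex_induced_map:
  assumes \<tau>: "clinear \<tau>" "range \<tau> \<subseteq> X" and K: "0 \<le> K" "\<And>y. norm (\<tau> y) \<le> K * norm y"
    and right: "\<And>y b. b \<in> B \<Longrightarrow> \<tau> (ract y b) = ract (\<tau> y) b"
  obtains \<psi> where "clinear \<psi>"
    "\<And>c a. a = \<psi> c \<longleftrightarrow> a \<in> A \<and> (\<forall>x\<in>X. \<tau> (lact c x) = lact a x)"
proof -
  have bl: "bounded_linear \<tau>"
    by (intro bounded_clinear_bounded_linear bounded_clinearI[of \<tau> K] \<tau> K)
  define \<Gamma> where "\<Gamma> = {(c, a). a \<in> A \<and> (\<forall>x\<in>X. \<tau> (lact c x) = lact a x)}"
  have bound: "norm a \<le> K * norm c" if "(c, a) \<in> \<Gamma>" for c a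
  proof (rule norm_le_by_action_on_X)
    fix x assume "x \<in> X"
    then have "lact a x = \<tau> (lact c x)" using that by (simp add: \<Gamma>_def)
    also have "norm \<dots> \<le> K * (norm c * norm x)"
      by (intro K(2)[THEN order_trans] mult_left_mono norm_lact_le K)
    finally show "norm (lact a x) \<le> K * norm c * norm x" by (simp add: mult.assoc)
  qed (use that K in \<open>auto simp: \<Gamma>_def\<close>)
  have zero: "lact 0 x = 0" for x using lact_diff_left[of 0 0 x] by simp
  have closed: "closed \<Gamma>"
  proof -
    have "\<Gamma> = snd -` A \<inter> (\<Inter>x\<in>X. {p. \<tau> (lact (fst p) x) = lact (snd p) x})"
      by (auto simp: \<Gamma>_def)
    moreover have "closed (snd -` A :: ('c \<times> 'c) set)"
      by (intro closed_vimage_snd closed_A)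
    moreover have "closed {p. \<tau> (lact (fst p) x) = lact (snd p) x}" for x
      by (intro closed_Collect_eq linear_continuous_on)
        (rule bounded_linear_compose[OF bounded_linear_lact_left bounded_linear_snd]
          bounded_linear_compose[OF bl bounded_linear_compose[OF bounded_linear_lact_left bounded_linear_fst]])+
    ultimately show ?thesis by (simp add: closed_Int closed_INT)
  qed
  have dom: "{lip y x | y x. x \<in> X} \<subseteq> fst ` \<Gamma>"
  proof safe
    fix y x assume "x \<in> X"
    then have "(lip y x, lip (\<tau> y) x) \<in> \<Gamma>"
      using \<tau>(2) by (auto simp: \<Gamma>_def lip_rip right rip_in_B intro!: lip_in_A)
    then show "lip y x \<in> fst ` \<Gamma>" by force
  qed
  have add: "(u + u', v + v') \<in> \<Gamma>" if "(u, v) \<in> \<Gamma>" "(u', v') \<in> \<Gamma>" for u v u' v'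
    using that csubspace_A by (auto simp: \<Gamma>_def lact_add_left lact_scaleC_left clinearD[OF \<tau>(1)]
        complex_vector.subspace_add)
  have scale: "(k *\<^sub>C u, k *\<^sub>C v) \<in> \<Gamma>" if "(u, v) \<in> \<Gamma>" for u v k
    using that csubspace_A by (auto simp: \<Gamma>_def lact_add_left lact_scaleC_left clinearD[OF \<tau>(1)]
        complex_vector.subspace_scale)
  have "(0, 0) \<in> \<Gamma>"
    using csubspace_A by (auto simp: \<Gamma>_def zero clinearD[OF \<tau>(1)] complex_vector.subspace_0)
  then obtain \<psi> where \<psi>: "clinear \<psi>" "\<And>u v. (u, v) \<in> \<Gamma> \<longleftrightarrow> v = \<psi> u"
    using bounded_closed_graph_total[OF add scale closed bound _ span_lip_YX dom] by blast
  then show thesis by (intro that[of \<psi>]) (auto simp: \<Gamma>_def)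
qed

text \<open>
  Every identity is checked by showing that its right-hand side has the property that
  characterises the value of \<open>\<tau>\<close> or of \<open>\<psi>\<close> on the left.
\<close>

theorem transfer:
  assumes \<phi>: "\<phi> \<in> bimodule_maps_over mD B"
  shows "\<exists>!(\<tau>, \<psi>). transfers \<phi> \<psi> \<tau>"
    and "transfers \<phi> \<psi> \<tau> \<Longrightarrow> bounded_clinear \<tau> \<and> onorm \<psi> \<le> onorm \<tau> \<and> onorm \<tau> \<le> onorm \<phi>"
proof -
  have \<phi>D: "bounded_linear \<phi>" "\<And>d. \<phi> d \<in> B"
    "\<And>b d. b \<in> B \<Longrightarrow> \<phi> (b \<odot>\<^sub>D d) = b \<odot>\<^sub>D \<phi> d" "\<And>b d. b \<in> B \<Longrightarrow> \<phi> (d \<odot>\<^sub>D b) = \<phi> d \<odot>\<^sub>D b"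
    using \<phi> by (auto simp: bimodule_maps_over_def bounded_clinear_bounded_linear)
  obtain \<tau> where \<tau>: "clinear \<tau>"
    and \<tau>_iff: "\<And>y w. w = \<tau> y \<longleftrightarrow> w \<in> X \<and> (\<forall>x\<in>X. rip x w = \<phi> (rip x y))"
    using ex_transfer_map[OF \<phi>] by blast
  have \<tau>X: "\<tau> y \<in> X" and \<tau>_rip: "x \<in> X \<Longrightarrow> rip x (\<tau> y) = \<phi> (rip x y)" for x y
    using \<tau>_iff[of "\<tau> y" y] by simp_all
  have K: "norm (\<tau> y) \<le> onorm \<phi> * norm y" for y
    by (rule transfer_norm_bound[OF \<phi>]) (simp_all add: \<tau>X \<tau>_rip)
  have bcl: "bounded_clinear \<tau>" using \<tau> K by (rule bounded_clinearI)
  then have bl: "bounded_linear \<tau>" by (rule bounded_clinear_bounded_linear)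
  have ran: "range \<tau> \<subseteq> X" using \<tau>X by auto
  have \<tau>_right: "\<tau> (ract y b) = ract (\<tau> y) b" if "b \<in> B" for y b
    by (rule sym, subst \<tau>_iff) (simp add: that \<tau>X ract_in_X rip_ract \<tau>_rip \<phi>D)
  have \<tau>_left: "\<tau> (lact a y) = lact a (\<tau> y)" if "a \<in> A" for y a
  proof (rule sym, subst \<tau>_iff, intro conjI ballI)
    fix x assume "x \<in> X"
    then have "lact (star a) x \<in> X" using that by (simp add: lact_in_X star_in_A)
    then have "rip (lact (star a) x) (\<tau> y) = \<phi> (rip (lact (star a) x) y)" by (rule \<tau>_rip)
    then show "rip x (lact a (\<tau> y)) = \<phi> (rip x (lact a y))" by (simp add: rip_lact star_star)
  qed (simp add: that \<tau>X lact_in_X)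
  have \<tau>_ract: "\<tau> (ract x d) = ract x (\<phi> d)" if "x \<in> X" for x d
    by (rule sym, subst \<tau>_iff) (simp add: that ract_in_X \<phi>D rip_ract rip_in_B)
  obtain \<psi> where \<psi>: "clinear \<psi>"
    and \<psi>_iff: "\<And>c a. a = \<psi> c \<longleftrightarrow> a \<in> A \<and> (\<forall>x\<in>X. \<tau> (lact c x) = lact a x)"
    using ex_induced_map[OF \<tau> ran onorm_pos_le[OF \<phi>D(1)] K \<tau>_right] by blast
  have \<psi>A: "\<psi> c \<in> A" and \<tau>_lact: "x \<in> X \<Longrightarrow> \<tau> (lact c x) = lact (\<psi> c) x" for c x
    using \<psi>_iff[of "\<psi> c" c] by simp_all
  have \<psi>_left: "\<psi> (a \<odot>\<^sub>C c) = a \<odot>\<^sub>C \<psi> c" if "a \<in> A" for a c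
    by (rule sym, subst \<psi>_iff) (simp add: that prod_in_A \<psi>A lact_mult \<tau>_left \<tau>_lact)
  have \<psi>_right: "\<psi> (c \<odot>\<^sub>C a) = \<psi> c \<odot>\<^sub>C a" if "a \<in> A" for a c
    by (rule sym, subst \<psi>_iff) (simp add: that prod_in_A \<psi>A lact_mult lact_in_X \<tau>_lact)
  have \<psi>_lip: "lip (\<tau> y) x = \<psi> (lip y x)" if "x \<in> X" for x y
    by (subst \<psi>_iff) (simp add: that \<tau>X lip_in_A lip_rip \<tau>_right rip_in_B)
  have \<psi>_le: "norm (\<psi> c) \<le> onorm \<tau> * norm c" for c
  proof (rule norm_le_by_action_on_X[OF \<psi>A])
    fix x assume "x \<in> X"
    then have "norm (lact (\<psi> c) x) \<le> onorm \<tau> * norm (lact c x)"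
      using onorm[OF bl, of "lact c x"] by (simp add: \<tau>_lact)
    also have "\<dots> \<le> onorm \<tau> * (norm c * norm x)"
      by (intro mult_left_mono norm_lact_le onorm_pos_le[OF bl])
    finally show "norm (lact (\<psi> c) x) \<le> onorm \<tau> * norm c * norm x" by (simp add: mult.assoc)
  qed (simp add: onorm_pos_le[OF bl])
  have "\<psi> \<in> bimodule_maps_over mC A"
    using bounded_clinearI[OF \<psi> \<psi>_le] \<psi>A \<psi>_left \<psi>_right by (auto simp: bimodule_maps_over_def)
  then have ex: "transfers \<phi> \<psi> \<tau>"
    using \<tau> \<tau>X \<tau>_lact \<tau>_left \<psi>_lip \<tau>_ract \<tau>_right \<tau>_rip
    by (auto simp: transfers_def transfer_identities_def)
  have unique: "\<tau>' = \<tau> \<and> \<psi>' = \<psi>" if t: "transfers \<phi> \<psi>' \<tau>'" for \<tau>' \<psi>'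
  proof
    show eq: "\<tau>' = \<tau>"
    proof
      fix y
      have "\<tau>' y \<in> X \<and> (\<forall>x\<in>X. rip x (\<tau>' y) = \<phi> (rip x y))"
        using t by (auto simp: transfers_def transfer_identities_def)
      then show "\<tau>' y = \<tau> y" by (rule iffD2[OF \<tau>_iff])
    qed
    show "\<psi>' = \<psi>"
    proof
      fix c
      have "\<psi>' c \<in> A \<and> (\<forall>x\<in>X. \<tau> (lact c x) = lact (\<psi>' c) x)"
        using t eq by (auto simp: transfers_def transfer_identities_def bimodule_maps_over_def)
      then show "\<psi>' c = \<psi> c" by (rule iffD2[OF \<psi>_iff])
    qed
  qed
  show "\<exists>!(\<tau>, \<psi>). transfers \<phi> \<psi> \<tau>"
  proof (rule ex1I[of _ "(\<tau>, \<psi>)"])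
    show "case (\<tau>, \<psi>) of (\<tau>, \<psi>) \<Rightarrow> transfers \<phi> \<psi> \<tau>" using ex by simp
    fix p assume "case p of (\<tau>, \<psi>) \<Rightarrow> transfers \<phi> \<psi> \<tau>"
    then show "p = (\<tau>, \<psi>)" using unique[of "snd p" "fst p"] by (cases p) simp
  qed
  have "onorm \<tau> \<le> onorm \<phi>" by (intro onorm_bound onorm_pos_le[OF \<phi>D(1)] K)
  moreover have "onorm \<psi> \<le> onorm \<tau>"
    by (intro onorm_bound onorm_pos_le[OF bl] \<psi>_le)
  ultimately show "bounded_clinear \<tau>' \<and> onorm \<psi>' \<le> onorm \<tau>' \<and> onorm \<tau>' \<le> onorm \<phi>"
    if "transfers \<phi> \<psi>' \<tau>'" for \<psi>' \<tau>'
    using unique[OF that] bcl by simp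
qed

end

text \<open>The density of \<open>rip Y X\<close> is turned into that of \<open>rip X Y\<close>, which is what the exchange of
  sides produces from the density of \<open>lip Y X\<close>.\<close>

lemma strongly_morita_equivalent_inclusions_inclusion_module:
  assumes "cstar_subalgebra A" "cstar_subalgebra B"
    and "strongly_morita_equivalent_inclusions A B lact ract lip rip X"
  shows "inclusion_module (*) (*) lact ract lip rip A B X"
proof -
  interpret strongly_morita_equivalent_inclusions A B lact ract lip rip X by (fact assms(3))
  have norm_sq: "norm (lip y y) = (norm y)\<^sup>2" "norm (rip y y) = (norm y)\<^sup>2" for y
    by (simp add: norm_lip[of y], simp add: norm_rip[of y])
  have "star ` {rip y x | y x. x \<in> X} = {rip x y | x y. x \<in> X}"
  proof (intro set_eqI iffI)
    fix d assume "d \<in> {rip x y | x y. x \<in> X}"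
    then obtain x y where "d = star (rip y x)" "x \<in> X" by (auto simp: rip_star)
    then show "d \<in> star ` {rip y x | y x. x \<in> X}" by blast
  next
    fix d assume "d \<in> star ` {rip y x | y x. x \<in> X}"
    then obtain y x where "d = rip x y" "x \<in> X" by (auto simp: rip_star)
    then show "d \<in> {rip x y | x y. x \<in> X}" by blast
  qed
  then have span_rip_XY: "closed_cspan {rip x y | x y. x \<in> X} = UNIV"
    using closed_cspan_star_UNIV[OF span_rip_YX] by simp
  have A: "csubspace A" "closed A" "x \<in> A \<Longrightarrow> y \<in> A \<Longrightarrow> x * y \<in> A" "x \<in> A \<Longrightarrow> star x \<in> A"
    and B: "csubspace B" "closed B" "u \<in> B \<Longrightarrow> v \<in> B \<Longrightarrow> u * v \<in> B" "u \<in> B \<Longrightarrow> star u \<in> B"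
    for x y u v
    using assms(1,2) by (auto simp: cstar_subalgebra_def)
  show ?thesis
    by (intro inclusion_module.intro two_sided_module.intro two_sided_module_axioms.intro
        inclusion_module_axioms.intro cstar_product_times)
      (rule lact_add_left lact_add_right lact_scaleC_left lact_scaleC_right lact_mult
        lip_add_left lip_scaleC_left lip_lact lip_star norm_sq ract_add_left ract_add_right
        ract_scaleC_left ract_scaleC_right ract_mult rip_add_right rip_scaleC_right rip_ract
        rip_star lact_ract rip_lact lip_ract lip_rip A B csubspace_X closed_X
        lact_in_X ract_in_X lip_in_A rip_in_B span_rip_XY span_lip_YX
        equalityD2[OF span_lip_XX] equalityD2[OF span_rip_XX]; assumption)+
qed

theorem proposition2p4:
  fixes A :: "'c::cstar_algebra set" and B :: "'d::cstar_algebra set"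
    and lact :: "'c \<Rightarrow> 'y::cbanach \<Rightarrow> 'y" and ract :: "'y \<Rightarrow> 'd \<Rightarrow> 'y"
    and lip :: "'y \<Rightarrow> 'y \<Rightarrow> 'c" and rip :: "'y \<Rightarrow> 'y \<Rightarrow> 'd"
    and X :: "'y set"
  assumes "cstar_subalgebra A" and "cstar_subalgebra B"
    and "closed_cspan {a * c | a c. a \<in> A} = UNIV"
    and "closed_cspan {b * d | b d. b \<in> B} = UNIV"
    and "strongly_morita_equivalent_inclusions A B lact ract lip rip X"
  shows
    "(\<forall>\<phi> \<in> bimodule_maps B.
        (\<exists>!(\<tau>\<psi> :: ('y \<Rightarrow> 'y) \<times> ('c \<Rightarrow> 'c)). case \<tau>\<psi> of (\<tau>, \<psi>) \<Rightarrow>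
            clinear \<tau> \<and> range \<tau> \<subseteq> X \<and> \<psi> \<in> bimodule_maps A \<and>
            transfer_identities A B lact ract lip rip X \<phi> \<psi> \<tau>) \<and>
        (\<forall>\<tau> \<psi>. clinear \<tau> \<and> range \<tau> \<subseteq> X \<and> \<psi> \<in> bimodule_maps A \<and>
            transfer_identities A B lact ract lip rip X \<phi> \<psi> \<tau> \<longrightarrow>
            bounded_clinear \<tau> \<and> onorm \<psi> \<le> onorm \<tau> \<and> onorm \<tau> \<le> onorm \<phi>)) \<and>
     (\<forall>\<psi> \<in> bimodule_maps A.
        (\<exists>!(\<tau>\<phi> :: ('y \<Rightarrow> 'y) \<times> ('d \<Rightarrow> 'd)). case \<tau>\<phi> of (\<tau>, \<phi>) \<Rightarrow>
            clinear \<tau> \<and> range \<tau> \<subseteq> X \<and> \<phi> \<in> bimodule_maps B \<and>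
            transfer_identities A B lact ract lip rip X \<phi> \<psi> \<tau>) \<and>
        (\<forall>\<tau> \<phi>. clinear \<tau> \<and> range \<tau> \<subseteq> X \<and> \<phi> \<in> bimodule_maps B \<and>
            transfer_identities A B lact ract lip rip X \<phi> \<psi> \<tau> \<longrightarrow>
            bounded_clinear \<tau> \<and> onorm \<phi> \<le> onorm \<tau> \<and> onorm \<tau> \<le> onorm \<psi>))"
proof -
  interpret inclusion_module "(*)" "(*)" lact ract lip rip A B X
    by (rule strongly_morita_equivalent_inclusions_inclusion_module[OF assms(1,2,5)])
  interpret dual: inclusion_module "\<lambda>x y. y * x" "\<lambda>x y. y * x"
      "\<lambda>d y. ract y d" "\<lambda>y c. lact c y" "\<lambda>y z. rip z y" "\<lambda>y z. lip z y" B A X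
    by (rule dual_inclusion)
  have maps: "bimodule_maps_over (*) S = bimodule_maps S"
    "bimodule_maps_over (\<lambda>x y. y * x) S = bimodule_maps S" for S :: "'z::cstar_algebra set"
    by (auto simp: bimodule_maps_over_def bimodule_maps_def)
  have flip: "transfer_identities B A (\<lambda>d y. ract y d) (\<lambda>y c. lact c y) (\<lambda>y z. rip z y)
      (\<lambda>y z. lip z y) X \<psi> \<phi> \<tau> \<longleftrightarrow> transfer_identities A B lact ract lip rip X \<phi> \<psi> \<tau>" for \<phi> \<psi> \<tau>
    unfolding transfer_identities_def by (rule iffI; (intro conjI allI ballI); simp)
  note here = transfer[unfolded transfers_def maps]
    and there = dual.transfer[unfolded dual.transfers_def maps flip]
  show ?thesis
  proof (intro conjI ballI allI impI)
    fix \<phi> assume "\<phi> \<in> bimodule_maps B"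
    then show "\<exists>!\<tau>\<psi>. case \<tau>\<psi> of (\<tau>, \<psi>) \<Rightarrow> clinear \<tau> \<and> range \<tau> \<subseteq> X \<and> \<psi> \<in> bimodule_maps A \<and>
        transfer_identities A B lact ract lip rip X \<phi> \<psi> \<tau>"
      by (rule here(1))
  next
    fix \<psi> assume "\<psi> \<in> bimodule_maps A"
    then show "\<exists>!\<tau>\<phi>. case \<tau>\<phi> of (\<tau>, \<phi>) \<Rightarrow> clinear \<tau> \<and> range \<tau> \<subseteq> X \<and> \<phi> \<in> bimodule_maps B \<and>
        transfer_identities A B lact ract lip rip X \<phi> \<psi> \<tau>"
      by (rule there(1))
  qed (use here(2) there(2) in metis)+
qed

end
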